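(* Let $(X_n)$ be a strictly stationary sequence of nonnegative random variables, jointly regularly varying with index $\alpha\in(0,\infty)$, and let $(a_n)$ be a sequence of positive real numbers with $n\Pr(X_1>a_n)\to 1$ as $n\to\infty$. Suppose that the finite-cluster condition and the mixing condition $\mathcal{A}'(a_n)$ hold. Let $M_n=\max\{X_1,\dots,X_n\}$. Then, as $n\to\infty$, $$\frac{M_n}{a_n}\xrightarrow{d} M,$$ where the limit $M$ is a Fréchet random variable with $$\Pr(M\le x)=e^{-\theta x^{-\alpha}},\qquad x>0,$$ and $$\theta=\lim_{r\to\infty}\lim_{x\to\infty}\Pr\big(M_r\le x \,\big|\, X_0>x\big).$$
   Context: The stationary sequence is regarded as indexed by $\mathbb{Z}$. Joint regular variation: a random vector $\boldsymbol{\xi}$ with values in $[0,\infty)^d$ is regularly varying with index $\alpha>0$ if, with $\|\cdot\|$ the max-norm, there is a random vector $\boldsymbol{\Theta}$ on $\{\mathbf{x}\in[0,\infty)^d:\|\mathbf{x}\|=1\}$ such that for every $u\in(0,\infty)$, as $x\to\infty$, the finite measures $\Pr(\|\boldsymbol{\xi}\|>ux,\ \boldsymbol{\xi}/\|\boldsymbol{\xi}\|\in\cdot\,)/\Pr(\|\boldsymbol{\xi}\|>x)$ converge weakly to $u^{-\alpha}\Pr(\boldsymbol{\Theta}\in\cdot\,)$. A strictly stationary nonnegative sequence $(X_n)$ is jointly regularly varying with index $\alpha$ if for every positive integer $k$ the vector $(X_1,\dots,X_k)$ is regularly varying with index $\alpha$. Finite-cluster condition: there exists a sequence of positive integers $(r_n)$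 such that $r_n\to\infty$ and $r_n/n\to0$ as $n\to\infty$ and such that for every $u>0$, $$\lim_{m\to\infty}\limsup_{n\to\infty}\Pr\Big(\max_{m\le|i|\le r_n}X_i>ua_n\,\Big|\,X_0>ua_n\Big)=0.$$ Mixing condition $\mathcal{A}'(a_n)$: there exists a sequence of positive integers $(r_n)$ such that $r_n\to\infty$ and $r_n/n\to0$ as $n\to\infty$ and such that, writing $\mathbb{E}=(0,\infty]$ (topologized so that a subset has compact closure iff it is bounded away from $0$) and $k_n=\lfloor n/r_n\rfloor$, for every nonnegative continuous function $f$ on $[0,1]\times\mathbb{E}$ with compact support, as $n\to\infty$, $$\operatorname{E}\Big[\exp\Big\{-\sum_{i=1}^n f\Big(\frac in,\frac{X_i}{a_n}\Big)\Big\}\Big]-\prod_{k=1}^{k_n}\operatorname{E}\Big[\exp\Big\{-\sum_{i=1}^{r_n}f\Big(\frac{kr_n}{n},\frac{X_i}{a_n}\Big)\Big\}\Big]\to0.$$ Under the finite-cluster condition, $\theta$ is strictly positive and equals the extremal index of $(X_n)$. The arrow $\xrightarrow{d}$ denotes convergence in distribution.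
   Formalization: The finite-cluster condition and the mixing condition A'(a_n) are assumed to hold with one and the same sequence (r_n); with two unrelated sequences the claim is false (for instance when extremes recur at distance of order √n). *)

theory Defs
  imports "HOL-Probability.Probability"
begin

(* A vector in R^d is an extensional function on {1..d}, as in PiE and PiM. *)

definition maxnorm :: "nat \<Rightarrow> (nat \<Rightarrow> real) \<Rightarrow> real" where
  "maxnorm d x = Max ((\<lambda>i. \<bar>x i\<bar>) ` {1..d})"

definition nonneg_sphere :: "nat \<Rightarrow> (nat \<Rightarrow> real) set" where
  "nonneg_sphere d = {x \<in> {1..d} \<rightarrow>\<^sub>E {0..}. maxnorm d x = 1}"

definition sphere_borel :: "nat \<Rightarrow> (nat \<Rightarrow> real) measure" where
  "sphere_borel d = restrict_space borel (nonneg_sphere d)"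

(* Weak convergence of finite Borel measures living on the subspace S. *)
definition weakly_converges_on ::
    "'b::topological_space set \<Rightarrow> ('c \<Rightarrow> 'b measure) \<Rightarrow> 'b measure \<Rightarrow> 'c filter \<Rightarrow> bool" where
  "weakly_converges_on S \<mu> \<nu> F \<longleftrightarrow>
     (\<forall>g :: 'b \<Rightarrow> real. continuous_on S g \<and> bounded (g ` S) \<longrightarrow>
        ((\<lambda>x. \<integral>y. g y \<partial>\<mu> x) \<longlongrightarrow> (\<integral>y. g y \<partial>\<nu>)) F)"

(* The measure P(|xi| > t, xi/|xi| in . ) on the sphere, for t > 0. Restricting the probability
   space first keeps xi = 0, where xi/|xi| is undefined, out of the domain of the map. *)
definition exceedance_angle ::
    "'a measure \<Rightarrow> nat \<Rightarrow> ('a \<Rightarrow> nat \<Rightarrow> real) \<Rightarrow> real \<Rightarrow> (nat \<Rightarrow> real) measure" where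
  "exceedance_angle M d \<xi> t =
     distr (restrict_space M {\<omega> \<in> space M. maxnorm d (\<xi> \<omega>) > t}) (sphere_borel d)
       (\<lambda>\<omega>. \<lambda>i\<in>{1..d}. \<xi> \<omega> i / maxnorm d (\<xi> \<omega>))"

(* Theta is the law of the spectral vector. If |xi| is bounded, the normalising factor
   is 1/0 = 0 for large x, and the convergence fails, as it should. *)
definition regularly_varying_vector ::
    "'a measure \<Rightarrow> nat \<Rightarrow> ('a \<Rightarrow> nat \<Rightarrow> real) \<Rightarrow> real \<Rightarrow> bool" where
  "regularly_varying_vector M d \<xi> \<alpha> \<longleftrightarrow>
     \<alpha> > 0 \<and>
     \<xi> \<in> measurable M (PiM {1..d} (\<lambda>_. borel)) \<and>
     (\<forall>\<omega>\<in>space M. \<forall>i\<in>{1..d}. 0 \<le> \<xi> \<omega> i) \<and>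
     (\<exists>\<Theta>. prob_space \<Theta> \<and> sets \<Theta> = sets (sphere_borel d) \<and>
        (\<forall>u>0. weakly_converges_on (nonneg_sphere d)
           (\<lambda>x. scale_measure (ennreal (1 / \<P>(\<omega> in M. maxnorm d (\<xi> \<omega>) > x)))
                  (exceedance_angle M d \<xi> (u * x)))
           (scale_measure (ennreal (u powr (- \<alpha>))) \<Theta>)
           at_top))"

definition jointly_regularly_varying ::
    "'a measure \<Rightarrow> (int \<Rightarrow> 'a \<Rightarrow> real) \<Rightarrow> real \<Rightarrow> bool" where
  "jointly_regularly_varying M X \<alpha> \<longleftrightarrow>
     (\<forall>k\<ge>1. regularly_varying_vector M k (\<lambda>\<omega>. \<lambda>i\<in>{1..k}. X (int i) \<omega>) \<alpha>)"

definition strictly_stationary :: "'a measure \<Rightarrow> (int \<Rightarrow> 'a \<Rightarrow> real) \<Rightarrow> bool" where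
  "strictly_stationary M X \<longleftrightarrow>
     (\<forall>i. X i \<in> borel_measurable M) \<and>
     (\<forall>J h. finite J \<longrightarrow>
        distr M (PiM J (\<lambda>_. borel)) (\<lambda>\<omega>. \<lambda>i\<in>J. X (i + h) \<omega>) =
        distr M (PiM J (\<lambda>_. borel)) (\<lambda>\<omega>. \<lambda>i\<in>J. X i \<omega>))"

(* r is a parameter of the next three definitions because the finite-cluster and the mixing
   condition are imposed with one and the same r. *)
definition block_length_sequence :: "(nat \<Rightarrow> nat) \<Rightarrow> bool" where
  "block_length_sequence r \<longleftrightarrow>
     (\<forall>n. r n > 0) \<and> filterlim r at_top sequentially \<and>
     (\<lambda>n. real (r n) / real n) \<longlonglongrightarrow> 0"

(* The index set of the maximum is nonempty as soon as r n >= m, hence for all large n. *)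
definition finite_cluster_condition ::
    "'a measure \<Rightarrow> (int \<Rightarrow> 'a \<Rightarrow> real) \<Rightarrow> (nat \<Rightarrow> real) \<Rightarrow> (nat \<Rightarrow> nat) \<Rightarrow> bool" where
  "finite_cluster_condition M X a r \<longleftrightarrow>
     (\<forall>u>0. (\<lambda>m. limsup (\<lambda>n. ereal
         \<P>(\<omega> in M. Max ((\<lambda>i. X i \<omega>) ` {i. int m \<le> abs i \<and> abs i \<le> int (r n)}) > u * a n
              \<bar> X 0 \<omega> > u * a n))) \<longlonglongrightarrow> 0)"

(* [0,1] x E with E = (0,\<infinity>]. *)
definition time_state_space :: "(real \<times> ereal) set" where
  "time_state_space = {0..1} \<times> {0<..}"

(* Functions on [0,1] x E are extended by 0, so that f(t, 0) = 0: a variable X_i that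
   vanishes does not contribute to the sums in the mixing condition. *)
definition test_function :: "(real \<times> ereal \<Rightarrow> real) \<Rightarrow> bool" where
  "test_function f \<longleftrightarrow>
     (\<forall>p. 0 \<le> f p) \<and> (\<forall>p. p \<notin> time_state_space \<longrightarrow> f p = 0) \<and>
     continuous_on time_state_space f \<and>
     compact (time_state_space \<inter> closure {p \<in> time_state_space. f p \<noteq> 0})"

definition mixing_condition ::
    "'a measure \<Rightarrow> (int \<Rightarrow> 'a \<Rightarrow> real) \<Rightarrow> (nat \<Rightarrow> real) \<Rightarrow> (nat \<Rightarrow> nat) \<Rightarrow> bool" where
  "mixing_condition M X a r \<longleftrightarrow>
     (\<forall>f. test_function f \<longrightarrow>
       (\<lambda>n. (\<integral>\<omega>. exp (- (\<Sum>i=1..n. f (real i / real n, ereal (X (int i) \<omega> / a n)))) \<partial>M)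
          - (\<Prod>k=1..n div r n.
              \<integral>\<omega>. exp (- (\<Sum>i=1..r n. f (real (k * r n) / real n, ereal (X (int i) \<omega> / a n)))) \<partial>M))
       \<longlonglongrightarrow> 0)"

definition partial_max :: "(int \<Rightarrow> 'a \<Rightarrow> real) \<Rightarrow> nat \<Rightarrow> 'a \<Rightarrow> real" where
  "partial_max X n \<omega> = Max ((\<lambda>i. X (int i) \<omega>) ` {1..n})"

(* Both limits exist and the iterated limit is \<theta>. *)
definition iterated_limit_theta ::
    "'a measure \<Rightarrow> (int \<Rightarrow> 'a \<Rightarrow> real) \<Rightarrow> real \<Rightarrow> bool" where
  "iterated_limit_theta M X \<theta> \<longleftrightarrow>
     (\<exists>L :: nat \<Rightarrow> real.
        (\<forall>r\<ge>1. ((\<lambda>x. \<P>(\<omega> in M. partial_max X r \<omega> \<le> x \<bar> X 0 \<omega> > x)) \<longlongrightarrow> L r) at_top) \<and>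
        L \<longlonglongrightarrow> \<theta>)"

(* \<mu> is the law of M; positivity of \<theta> makes it a genuine Frechet law. *)
definition frechet_law :: "real \<Rightarrow> real \<Rightarrow> real measure \<Rightarrow> bool" where
  "frechet_law \<theta> \<alpha> \<mu> \<longleftrightarrow>
     \<theta> > 0 \<and> \<alpha> > 0 \<and> real_distribution \<mu> \<and>
     (\<forall>x>0. measure \<mu> {..x} = exp (- \<theta> * x powr (- \<alpha>)))"

end

theory Submission
  imports Defs "HOL-Real_Asymp.Real_Asymp"
begin

text \<open>
  Write \<open>p(x) = P(X\<^sub>0 > x)\<close>, \<open>b\<^sub>k(x) = P(M\<^sub>k > x)\<close> and \<open>q\<^sub>l(x) = P(X\<^sub>0 > x, M\<^sub>l \<le> x)\<close>; in the theory these
  are \<open>tail\<close>, \<open>block\<close> and \<open>last_exceedance\<close>. Splitting \<open>{M\<^sub>k > x}\<close> according to the last exceedance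
  and shifting by stationarity gives \<open>b\<^sub>k = q\<^sub>0 + ... + q\<^sub>k\<^sub>-\<^sub>1\<close>, and everything rests on this
  identity.

  Existence of the extremal index: joint regular variation yields limits of \<open>b\<^sub>k(x) / p(x)\<close>
  as \<open>x\<close> grows (\<open>block_tail_ratio_limit\<close>), hence limits \<open>L\<^sub>l\<close> of \<open>q\<^sub>l(x) / p(x)\<close>, which is the
  conditional probability in the definition of \<open>\<theta>\<close>. The \<open>L\<^sub>l\<close> decrease to some \<open>\<theta> \<ge> 0\<close>. If, given an
  exceedance at time \<open>0\<close>, another one occurs at time \<open>m\<close> or later in the window with probability at most
  one half, then with conditional probability at least one half the last exceedance in the window
  falls among the first \<open>m\<close> times, so \<open>L\<^sub>l \<ge> 1/(2m)\<close>
  for every \<open>l\<close> and \<open>\<theta> > 0\<close> (\<open>extremal_index\<close>).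

  Size of the blocks: for \<open>l \<ge> m\<close> the difference \<open>q\<^sub>m - q\<^sub>l\<close> is bounded by the probability of a late
  return. The identity for \<open>b\<^sub>k\<close> is therefore uniform over blocks of the growing length \<open>r\<^sub>n\<close>, so that
  \<open>b(u a\<^sub>n) ~ \<theta> r\<^sub>n p(u a\<^sub>n)\<close> for such blocks (\<open>block_exceedance_limit\<close>), and the expected number of
  blocks with an exceedance of \<open>u a\<^sub>n\<close> tends to \<open>\<theta> u\<^sup>-\<^sup>\<alpha>\<close>.

  Passage to the limit: the mixing condition compares Laplace functionals, that is, only continuous
  functions of the observations. It is applied to a steep ramp of height \<open>s\<close> between two levels,
  constant in time. The Laplace functional of such a ramp squeezes the probability of no exceedance,
  up to an error \<open>e\<^sup>-\<^sup>s\<close> and a small change of level (\<open>laplace_bounds\<close>), both for the whole sample and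
  for one block. The power \<open>(1 - b(u a\<^sub>n))\<^sup>k\<close> over \<open>k = n div r\<^sub>n\<close> blocks tends to
  \<open>exp (- \<theta> u\<^sup>-\<^sup>\<alpha>)\<close>; finally \<open>s\<close> tends to infinity and the two levels merge (\<open>block_limit\<close>).
\<close>

section \<open>Analytic preliminaries\<close>

lemma scale_measure_eq_density: "scale_measure c M = density M (\<lambda>_. c)"
  by (rule measure_eqI) (auto simp: emeasure_density nn_integral_cmult_indicator)

lemma integral_scale_measure:
  fixes f :: "'a \<Rightarrow> real"
  assumes "f \<in> borel_measurable M" "0 \<le> c"
  shows "(\<integral>x. f x \<partial>scale_measure (ennreal c) M) = c * (\<integral>x. f x \<partial>M)"
  using assms by (simp add: scale_measure_eq_density integral_density)

text \<open>The Poisson limit of the probability that none of \<open>k n\<close> independent events of probability \<open>y n\<close>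
occurs; it follows from \<open>- y - 2 y\<^sup>2 \<le> ln (1 - y) \<le> - y\<close>.\<close>

lemma tendsto_one_minus_power_exp:
  fixes y :: "nat \<Rightarrow> real" and k :: "nat \<Rightarrow> nat"
  assumes y: "\<And>n. 0 \<le> y n" and y0: "y \<longlonglongrightarrow> 0" and c: "(\<lambda>n. real (k n) * y n) \<longlonglongrightarrow> c"
  shows "(\<lambda>n. (1 - y n) ^ k n) \<longlonglongrightarrow> exp (- c)"
proof (rule tendsto_sandwich)
  have half: "eventually (\<lambda>n. y n < 1/2) sequentially"
    using y0 by (rule order_tendstoD) simp
  show "eventually (\<lambda>n. exp (- (real (k n) * y n) - 2 * (real (k n) * y n) * y n) \<le> (1 - y n) ^ k n) sequentially"
    using half
  proof eventually_elim
    case (elim n)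
    have "real (k n) * (- y n - 2 * (y n)\<^sup>2) \<le> real (k n) * ln (1 - y n)"
      using ln_one_minus_pos_lower_bound[of "y n"] y[of n] elim by (intro mult_left_mono) auto
    then have "exp (- (real (k n) * y n) - 2 * (real (k n) * y n) * y n) \<le> exp (real (k n) * ln (1 - y n))"
      by (simp add: algebra_simps power2_eq_square)
    also have "\<dots> = (1 - y n) ^ k n" using elim by (simp add: exp_of_nat_mult)
    finally show ?case .
  qed
  show "eventually (\<lambda>n. (1 - y n) ^ k n \<le> exp (- (real (k n) * y n))) sequentially"
    using half
  proof eventually_elim
    case (elim n)
    have "(1 - y n) ^ k n \<le> exp (- y n) ^ k n"
      using elim exp_ge_add_one_self[of "- y n"] by (intro power_mono) auto
    then show ?case by (simp add: exp_of_nat_mult[symmetric])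
  qed
  have "(\<lambda>n. exp (- (real (k n) * y n) - 2 * (real (k n) * y n) * y n)) \<longlonglongrightarrow> exp (- c - 2 * c * 0)"
    by (intro tendsto_intros c y0)
  then show "(\<lambda>n. exp (- (real (k n) * y n) - 2 * (real (k n) * y n) * y n)) \<longlonglongrightarrow> exp (- c)" by simp
  show "(\<lambda>n. exp (- (real (k n) * y n))) \<longlonglongrightarrow> exp (- c)"
    by (intro tendsto_intros c)
qed

lemma frechet_law_exists:
  assumes "\<theta> > 0" "\<alpha> > 0"
  shows "\<exists>\<mu>. frechet_law \<theta> \<alpha> \<mu>"
proof -
  define F where "F x = (if x > 0 then exp (- \<theta> * x powr (- \<alpha>)) else 0)" for x :: real
  have mono: "F x \<le> F y" if "x \<le> y" for x y
    using that assms by (auto simp: F_def intro!: mult_left_mono powr_mono2')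
  have cont: "continuous (at_right a) F" for a
  proof -
    \<comment> \<open>At the origin right-continuity holds because \<open>x\<^sup>-\<^sup>\<alpha>\<close> tends to infinity from the right.\<close>
    consider "a > 0" | "a = 0" | "a < 0" by linarith
    then show ?thesis
    proof cases
      case 1
      have "isCont (\<lambda>x. exp (- \<theta> * x powr (- \<alpha>))) a"
        using 1 by (intro continuous_intros) auto
      moreover have "eventually (\<lambda>x. F x = exp (- \<theta> * x powr (- \<alpha>))) (nhds a)"
        using eventually_nhds_in_open[of "{0<..}" a] 1 by (auto elim!: eventually_mono simp: F_def)
      ultimately have "isCont F a" by (simp add: isCont_cong)
      then show ?thesis by (rule continuous_at_imp_continuous_within)
    next
      case 2
      have "LIM x at_right 0. \<theta> * x powr (- \<alpha>) :> at_top"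
        using assms by real_asymp
      then have "((\<lambda>x. exp (- (\<theta> * x powr (- \<alpha>)))) \<longlongrightarrow> 0) (at_right 0)"
        by (intro filterlim_compose[OF exp_at_bot] filterlim_compose[OF filterlim_uminus_at_bot_at_top])
      then have "(F \<longlongrightarrow> 0) (at_right 0)"
        by (rule Lim_transform_eventually) (auto simp: F_def eventually_at_right_less intro: eventually_mono[OF eventually_at_right_less])
      then show ?thesis using 2 by (simp add: continuous_within F_def)
    next
      case 3
      have "eventually (\<lambda>x. F x = 0) (nhds a)"
        using eventually_nhds_in_open[of "{..<0}" a] 3 by (auto elim!: eventually_mono simp: F_def)
      then have "isCont F a" by (simp add: isCont_cong)
      then show ?thesis by (rule continuous_at_imp_continuous_within)
    qed
  qed
  have bot: "(F \<longlongrightarrow> 0) at_bot"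
    by (rule tendsto_eventually, rule eventually_mono[OF eventually_le_at_bot[of 0]]) (auto simp: F_def)
  have "((\<lambda>x. exp (- \<theta> * x powr (- \<alpha>))) \<longlongrightarrow> exp (- \<theta> * 0)) at_top"
    by (intro tendsto_intros tendsto_neg_powr filterlim_ident) (use assms in auto)
  then have "((\<lambda>x. exp (- \<theta> * x powr (- \<alpha>))) \<longlongrightarrow> 1) at_top" by simp
  then have top: "(F \<longlongrightarrow> 1) at_top"
    by (rule Lim_transform_eventually, intro eventually_mono[OF eventually_gt_at_top[of 0]])
       (auto simp: F_def)
  have "real_distribution (interval_measure F)"
    by (rule real_distribution_interval_measure[OF mono cont bot top])
  moreover have "measure (interval_measure F) {..x} = F x" for x
    by (rule measure_interval_measure_Iic[OF mono cont bot])
  ultimately show ?thesis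
    using assms by (auto simp: frechet_law_def F_def intro!: exI[of _ "interval_measure F"])
qed

section \<open>Tails of products with a regularly varying radius\<close>

definition clamp01 :: "real \<Rightarrow> real" where
  "clamp01 s = min 1 (max 0 s)"

text \<open>The piecewise linear bumps of width \<open>2/N\<close> centred at the grid points \<open>j/N\<close>. Written as a difference of
consecutive clamped shifts, they telescope to a continuous partition of unity of \<open>[0, 1]\<close>.\<close>

definition hat :: "nat \<Rightarrow> nat \<Rightarrow> real \<Rightarrow> real" where
  "hat N j t = clamp01 (real N * t - real j + 1) - clamp01 (real N * t - real j)"

lemma continuous_on_clamp01 [continuous_intros]:
  "continuous_on A f \<Longrightarrow> continuous_on A (\<lambda>x. clamp01 (f x))"
  unfolding clamp01_def by (intro continuous_intros)

lemma continuous_on_hat: "continuous_on A (hat N j)"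
  unfolding hat_def by (intro continuous_intros)

lemma hat_bounds: "0 \<le> hat N j t" "hat N j t \<le> 1"
  by (auto simp: hat_def clamp01_def)

lemma hat_support: "hat N j t \<noteq> 0 \<Longrightarrow> real j - 1 < real N * t \<and> real N * t < real j + 1"
  by (auto simp: hat_def clamp01_def split: if_splits)

lemma sum_hat:
  assumes "0 \<le> t" "t \<le> 1"
  shows "(\<Sum>j\<le>N. hat N j t) = 1"
proof -
  have "(\<Sum>j\<le>n. hat N j t) = clamp01 (real N * t + 1) - clamp01 (real N * t - real n)" for n
    by (induction n) (auto simp: hat_def algebra_simps)
  moreover have "real N * t \<le> real N" "0 \<le> real N * t"
    using assms by (auto simp: mult_left_le)
  ultimately show ?thesis by (auto simp: clamp01_def)
qed

lemma weighted_mean_le: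
  fixes w v :: "nat \<Rightarrow> real"
  assumes "\<And>j. j \<in> J \<Longrightarrow> 0 \<le> w j" "sum w J = 1" "\<And>j. j \<in> J \<Longrightarrow> w j \<noteq> 0 \<Longrightarrow> v j \<le> b"
  shows "(\<Sum>j\<in>J. v j * w j) \<le> b"
proof -
  have "(\<Sum>j\<in>J. v j * w j) \<le> (\<Sum>j\<in>J. b * w j)"
    using assms by (intro sum_mono) (metis mult_eq_0_iff mult_right_mono order_refl)
  also have "\<dots> = b" using assms(2) by (simp flip: sum_distrib_left)
  finally show ?thesis .
qed

text \<open>The event \<open>R T > x\<close> couples the radius with the angle, whereas the hypothesis only controls products of a
radial event and a continuous function of the angle. On the support of the \<open>j\<close>-th bump the angle
differs from \<open>j/N\<close> by at most \<open>1/N\<close>, so there the event contains \<open>R > (N/(j-1)) x\<close> and is contained in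
\<open>R > (N/(j+1)) x\<close>. Summing the limits over the partition of unity gives Riemann-type sums
\<open>\<Sum>\<^sub>j ((j \<plusminus> 1)/N)\<^sup>\<alpha> E[h\<^sub>j(S)]\<close>, and both are close to \<open>E[S\<^sup>\<alpha>]\<close> because \<open>t\<^sup>\<alpha>\<close> is uniformly continuous.\<close>

lemma product_tail_limit:
  fixes R T :: "'a \<Rightarrow> real" and S :: "'b \<Rightarrow> real"
  assumes "prob_space M" "prob_space \<Theta>"
    and [measurable]: "R \<in> borel_measurable M" "T \<in> borel_measurable M" "S \<in> borel_measurable \<Theta>"
    and T: "\<And>\<omega>. \<omega> \<in> space M \<Longrightarrow> 0 \<le> T \<omega> \<and> T \<omega> \<le> 1"
    and S: "\<And>s. s \<in> space \<Theta> \<Longrightarrow> 0 \<le> S s \<and> S s \<le> 1"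
    and "\<alpha> > 0"
    and lim: "\<And>u h. u > 0 \<Longrightarrow> continuous_on UNIV h \<Longrightarrow> (\<And>t. 0 \<le> h t \<and> h t \<le> 1) \<Longrightarrow>
       ((\<lambda>x. (\<integral>\<omega>. indicator {\<omega>. R \<omega> > u * x} \<omega> * h (T \<omega>) \<partial>M) / measure M {\<omega>\<in>space M. R \<omega> > x})
          \<longlongrightarrow> u powr (-\<alpha>) * (\<integral>s. h (S s) \<partial>\<Theta>)) at_top"
  shows "((\<lambda>x. measure M {\<omega>\<in>space M. R \<omega> * T \<omega> > x} / measure M {\<omega>\<in>space M. R \<omega> > x})
            \<longlongrightarrow> (\<integral>s. S s powr \<alpha> \<partial>\<Theta>)) at_top"
proof -
  interpret prob_space M by fact
  interpret \<Theta>: prob_space \<Theta> by fact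
  define C where "C = (\<integral>s. S s powr \<alpha> \<partial>\<Theta>)"
  define p where "p x = measure M {\<omega>\<in>space M. R \<omega> > x}" for x
  define f where "f x = measure M {\<omega>\<in>space M. R \<omega> * T \<omega> > x} / p x" for x
  define G where "G N j u x = (\<integral>\<omega>. indicator {\<omega>. R \<omega> > u * x} \<omega> * hat N j (T \<omega>) \<partial>M)" for N j u x
  have [measurable]: "hat N j \<in> borel_measurable borel" for N j
    by (rule borel_measurable_continuous_onI[OF continuous_on_hat])
  have abs_hat: "\<bar>hat N j t\<bar> \<le> 1" for N j t
    using hat_bounds[of N j t] by simp
  have int_hatS: "integrable \<Theta> (\<lambda>s. hat N j (S s))" for N j
    by (rule \<Theta>.integrable_const_bound[of _ 1]) (auto simp: abs_hat)
  have int_S: "integrable \<Theta> (\<lambda>s. S s powr \<alpha>)"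
    by (rule \<Theta>.integrable_const_bound[of _ 1])
       (use S \<open>\<alpha> > 0\<close> in \<open>auto intro!: AE_I2 powr_le1\<close>)
  have int_G: "integrable M (\<lambda>\<omega>. indicator {\<omega>. R \<omega> > u * x} \<omega> * hat N j (T \<omega>))" for N j u x
    by (rule integrable_const_bound[of _ 1]) (auto simp: abs_hat indicator_def)
  have int_RT: "integrable M (\<lambda>\<omega>. indicator {\<omega>. R \<omega> * T \<omega> > x} \<omega> :: real)" for x
    by (rule integrable_const_bound[of _ 1]) (auto simp: indicator_def)
  have tail_eq: "measure M {\<omega>\<in>space M. R \<omega> * T \<omega> > x}
      = (\<integral>\<omega>. indicator {\<omega>. R \<omega> * T \<omega> > x} \<omega> \<partial>M)" for x
    by (subst Bochner_Integration.integral_indicator) (auto intro!: arg_cong[where f="measure M"])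
  have limG: "((\<lambda>x. G N j u x / p x) \<longlongrightarrow> u powr (-\<alpha>) * (\<integral>s. hat N j (S s) \<partial>\<Theta>)) at_top"
    if "u > 0" for N j u
    unfolding G_def p_def by (rule lim[OF that continuous_on_hat]) (simp add: hat_bounds)
  have pnn: "0 \<le> p x" for x by (simp add: p_def)
  have ev: "eventually (\<lambda>x. \<bar>f x - C\<bar> < 2 * e) at_top" if "e > 0" for e
  proof -
    have "uniformly_continuous_on {0..2} (\<lambda>t::real. t powr \<alpha>)"
      by (intro compact_uniformly_continuous continuous_on_powr') (use \<open>\<alpha> > 0\<close> in auto)
    then obtain d where "d > 0" and d: "\<And>s t. s \<in> {0..2} \<Longrightarrow> t \<in> {0..2} \<Longrightarrow> \<bar>s - t\<bar> < d \<Longrightarrow>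
        \<bar>s powr \<alpha> - t powr \<alpha>\<bar> < e"
      using \<open>e > 0\<close> unfolding uniformly_continuous_on_def dist_real_def by (metis abs_minus_commute)
    obtain N :: nat where N: "N > 0" "2 / real N < d"
    proof -
      obtain n :: nat where "n > 0" "inverse (real n) < d / 2"
        using ex_inverse_of_nat_less[of "d/2"] \<open>d > 0\<close> by auto
      then show ?thesis by (intro that[of n]) (auto simp: field_simps)
    qed
    have close: "\<bar>(real (j + 1) / real N) powr \<alpha> - s powr \<alpha>\<bar> < e"
                "\<bar>(real (j - 1) / real N) powr \<alpha> - s powr \<alpha>\<bar> < e"
      if "hat N j s \<noteq> 0" "0 \<le> s" "s \<le> 1" "j \<le> N" for j s
    proof -
      have *: "real j - 1 < real N * s" "real N * s < real j + 1"
        using hat_support[OF that(1)] by auto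
      have 1: "\<bar>real (j + 1) / real N - s\<bar> < d"
      proof -
        have "\<bar>real (j + 1) / real N - s\<bar> \<le> 2 / real N"
        proof -
          have "real (j + 1) / real N - s = (real (j + 1) - real N * s) / real N"
            using N(1) by (simp add: field_simps)
          moreover have "\<bar>real (j + 1) - real N * s\<bar> \<le> 2" using * by (auto simp: abs_le_iff)
          ultimately show ?thesis by (simp add: abs_divide divide_right_mono)
        qed
        with N show ?thesis by linarith
      qed
      have 2: "\<bar>real (j - 1) / real N - s\<bar> < d"
      proof -
        have "\<bar>real (j - 1) / real N - s\<bar> \<le> 2 / real N"
        proof -
          have "real (j - 1) / real N - s = (real (j - 1) - real N * s) / real N"
            using N(1) by (simp add: field_simps)
          moreover have "\<bar>real (j - 1) - real N * s\<bar> \<le> 2"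
            using * that by (cases j) (auto simp: abs_le_iff)
          ultimately show ?thesis by (simp add: abs_divide divide_right_mono)
        qed
        with N show ?thesis by linarith
      qed
      show "\<bar>(real (j + 1) / real N) powr \<alpha> - s powr \<alpha>\<bar> < e"
        by (rule d[OF _ _ 1]) (use that N in \<open>auto simp: field_simps\<close>)
      show "\<bar>(real (j - 1) / real N) powr \<alpha> - s powr \<alpha>\<bar> < e"
        by (rule d[OF _ _ 2]) (use that N in \<open>auto simp: field_simps\<close>)
    qed
    \<comment> \<open>The limits of the upper and the lower sum. The lower sum starts at \<open>j = 2\<close>: for \<open>j \<le> 1\<close> the angle may
vanish on the support of the bump and no radial event forces \<open>R T > x\<close>.\<close>
    define U where "U = (\<Sum>j\<le>N. (real N / real (j+1)) powr (-\<alpha>) * (\<integral>s. hat N j (S s) \<partial>\<Theta>))"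
    define L where "L = (\<Sum>j=2..N. (real N / real (j-1)) powr (-\<alpha>) * (\<integral>s. hat N j (S s) \<partial>\<Theta>))"
    have inv: "(real N / real i) powr (-\<alpha>) = (real i / real N) powr \<alpha>" for i
      by (metis powr_minus_divide powr_divide of_nat_0_le_iff inverse_divide powr_minus divide_powr_uminus inverse_eq_divide powr_one_eq_one)
    have U_le: "U \<le> C + e"
    proof -
      have "U = (\<integral>s. (\<Sum>j\<le>N. (real (j+1) / real N) powr \<alpha> * hat N j (S s)) \<partial>\<Theta>)"
        unfolding U_def inv by (subst Bochner_Integration.integral_sum) (auto intro: int_hatS)
      also have "\<dots> \<le> (\<integral>s. S s powr \<alpha> + e \<partial>\<Theta>)"
      proof (intro integral_mono)
        fix s assume s: "s \<in> space \<Theta>"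
        show "(\<Sum>j\<le>N. (real (j+1) / real N) powr \<alpha> * hat N j (S s)) \<le> S s powr \<alpha> + e"
        proof (rule weighted_mean_le)
          show "(real (j+1) / real N) powr \<alpha> \<le> S s powr \<alpha> + e" if "j \<in> {..N}" "hat N j (S s) \<noteq> 0" for j
            using close(1)[OF that(2)] S[OF s] that(1) by auto
        qed (use S[OF s] in \<open>auto simp: hat_bounds intro: sum_hat\<close>)
      qed (auto intro!: int_hatS int_S)
      also have "\<dots> = C + e"
        unfolding C_def using int_S by (simp add: \<Theta>.prob_space)
      finally show ?thesis .
    qed
    have L_ge: "C - e \<le> L"
    proof -
      have "C - e = (\<integral>s. S s powr \<alpha> - e \<partial>\<Theta>)"
        unfolding C_def using int_S by (simp add: \<Theta>.prob_space)
      also have "\<dots> \<le> (\<integral>s. (\<Sum>j\<le>N. (real (j-1) / real N) powr \<alpha> * hat N j (S s)) \<partial>\<Theta>)"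
      proof (intro integral_mono)
        fix s assume s: "s \<in> space \<Theta>"
        have "(\<Sum>j\<le>N. - ((real (j-1) / real N) powr \<alpha>) * hat N j (S s)) \<le> - (S s powr \<alpha> - e)"
        proof (rule weighted_mean_le)
          show "- ((real (j-1) / real N) powr \<alpha>) \<le> - (S s powr \<alpha> - e)" if "j \<in> {..N}" "hat N j (S s) \<noteq> 0" for j
            using close(2)[OF that(2)] S[OF s] that(1) by auto
        qed (use S[OF s] in \<open>auto simp: hat_bounds intro: sum_hat\<close>)
        then show "S s powr \<alpha> - e \<le> (\<Sum>j\<le>N. (real (j-1) / real N) powr \<alpha> * hat N j (S s))"
          by (simp add: sum_negf)
      qed (auto intro!: int_hatS int_S)
      also have "\<dots> = (\<Sum>j\<le>N. (real (j-1) / real N) powr \<alpha> * (\<integral>s. hat N j (S s) \<partial>\<Theta>))"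
        by (subst Bochner_Integration.integral_sum) (auto intro: int_hatS)
      also have "\<dots> = L"
        \<comment> \<open>The weights with \<open>j \<le> 1\<close> vanish, since natural subtraction makes \<open>j - 1 = 0\<close>.\<close>
        unfolding L_def inv by (rule sum.mono_neutral_right) (auto simp: not_le le_Suc_eq numeral_2_eq_2)
      finally show ?thesis .
    qed
    have f_le: "f x \<le> (\<Sum>j\<le>N. G N j (real N / real (j+1)) x / p x)" if "x > 0" for x
    proof -
      have "measure M {\<omega>\<in>space M. R \<omega> * T \<omega> > x}
          \<le> (\<integral>\<omega>. (\<Sum>j\<le>N. indicator {\<omega>. R \<omega> > (real N / real (j+1)) * x} \<omega> * hat N j (T \<omega>)) \<partial>M)"
        unfolding tail_eq
      proof (intro integral_mono)
        fix \<omega> assume \<omega>: "\<omega> \<in> space M"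
        note T\<omega> = T[OF \<omega>]
        show "indicator {\<omega>. R \<omega> * T \<omega> > x} \<omega>
            \<le> (\<Sum>j\<le>N. indicator {\<omega>. R \<omega> > (real N / real (j+1)) * x} \<omega> * hat N j (T \<omega>))"
        proof (cases "R \<omega> * T \<omega> > x")
          case True
          then have "R \<omega> > 0" using \<open>x > 0\<close> T\<omega> by (metis less_trans not_less mult_nonpos_nonneg)
          have "hat N j (T \<omega>) \<le> indicator {\<omega>. R \<omega> > (real N / real (j+1)) * x} \<omega> * hat N j (T \<omega>)" for j
          proof (cases "hat N j (T \<omega>) = 0")
            case False
            then have "real N * T \<omega> < real (j + 1)" using hat_support[of N j "T \<omega>"] by auto
            then have "R \<omega> * (real N * T \<omega>) \<le> R \<omega> * real (j + 1)"
              using \<open>R \<omega> > 0\<close> by (intro mult_left_mono) auto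
            moreover have "real N * x < real N * (R \<omega> * T \<omega>)" using True N by simp
            ultimately have "real N * x < R \<omega> * real (j + 1)" by (simp add: mult_ac)
            then have "R \<omega> > (real N / real (j+1)) * x" by (simp add: field_simps)
            then show ?thesis by simp
          qed simp
          then have "(\<Sum>j\<le>N. hat N j (T \<omega>)) \<le> (\<Sum>j\<le>N. indicator {\<omega>. R \<omega> > (real N / real (j+1)) * x} \<omega> * hat N j (T \<omega>))"
            by (rule sum_mono)
          then show ?thesis using sum_hat[of "T \<omega>" N] T\<omega> True by simp
        next
          case False
          then show ?thesis by (simp add: sum_nonneg hat_bounds)
        qed
      qed (intro int_RT Bochner_Integration.integrable_sum int_G)+
      also have "\<dots> = (\<Sum>j\<le>N. G N j (real N / real (j+1)) x)"
        unfolding G_def by (subst Bochner_Integration.integral_sum) (rule int_G, rule refl)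
      finally show ?thesis
        unfolding f_def by (simp add: divide_right_mono pnn flip: sum_divide_distrib)
    qed
    have f_ge: "(\<Sum>j=2..N. G N j (real N / real (j-1)) x / p x) \<le> f x" if "x > 0" for x
    proof -
      have "(\<Sum>j=2..N. G N j (real N / real (j-1)) x)
          = (\<integral>\<omega>. (\<Sum>j=2..N. indicator {\<omega>. R \<omega> > (real N / real (j-1)) * x} \<omega> * hat N j (T \<omega>)) \<partial>M)"
        unfolding G_def by (subst Bochner_Integration.integral_sum) (rule int_G, rule refl)
      also have "\<dots> \<le> measure M {\<omega>\<in>space M. R \<omega> * T \<omega> > x}"
        unfolding tail_eq
      proof (intro integral_mono)
        fix \<omega> assume \<omega>: "\<omega> \<in> space M"
        note T\<omega> = T[OF \<omega>]
        have "indicator {\<omega>. R \<omega> > (real N / real (j-1)) * x} \<omega> * hat N j (T \<omega>)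
            \<le> indicator {\<omega>. R \<omega> * T \<omega> > x} \<omega> * hat N j (T \<omega>)" if "j \<in> {2..N}" for j
        proof (cases "hat N j (T \<omega>) \<noteq> 0 \<and> R \<omega> > (real N / real (j-1)) * x")
          case True
          have j: "real (j - 1) > 0" using that by simp
          have R: "R \<omega> * real (j - 1) > real N * x" using True j by (simp add: field_simps)
          moreover have "0 < real N * x" using N \<open>x > 0\<close> by simp
          ultimately have "0 < R \<omega> * real (j - 1)" by linarith
          then have "R \<omega> > 0" using j by (simp add: zero_less_mult_iff)
          have "real (j - 1) \<le> real N * T \<omega>" using hat_support[of N j "T \<omega>"] True that by auto
          then have "R \<omega> * real (j - 1) \<le> R \<omega> * (real N * T \<omega>)"
            using \<open>R \<omega> > 0\<close> by (intro mult_left_mono) auto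
          with R have "real N * x < real N * (R \<omega> * T \<omega>)" by (simp add: mult_ac)
          then have "R \<omega> * T \<omega> > x" using N by simp
          then show ?thesis by (auto simp: hat_bounds split: split_indicator)
        qed (auto simp: hat_bounds split: split_indicator)
        then have "(\<Sum>j=2..N. indicator {\<omega>. R \<omega> > (real N / real (j-1)) * x} \<omega> * hat N j (T \<omega>))
            \<le> (\<Sum>j=2..N. indicator {\<omega>. R \<omega> * T \<omega> > x} \<omega> * hat N j (T \<omega>))"
          by (rule sum_mono)
        also have "\<dots> \<le> (\<Sum>j\<le>N. indicator {\<omega>. R \<omega> * T \<omega> > x} \<omega> * hat N j (T \<omega>))"
          by (rule sum_mono2) (auto simp: hat_bounds)
        also have "\<dots> = indicator {\<omega>. R \<omega> * T \<omega> > x} \<omega>"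
          using sum_hat[of "T \<omega>" N] T\<omega> by (simp flip: sum_distrib_left)
        finally show "(\<Sum>j=2..N. indicator {\<omega>. R \<omega> > (real N / real (j-1)) * x} \<omega> * hat N j (T \<omega>))
            \<le> indicator {\<omega>. R \<omega> * T \<omega> > x} \<omega>" .
      qed (intro int_RT Bochner_Integration.integrable_sum int_G)+
      finally show ?thesis
        unfolding f_def by (simp add: divide_right_mono pnn flip: sum_divide_distrib)
    qed
    have "((\<lambda>x. \<Sum>j\<le>N. G N j (real N / real (j+1)) x / p x) \<longlongrightarrow> U) at_top"
      unfolding U_def by (intro tendsto_sum limG) (use N in auto)
    then have 1: "eventually (\<lambda>x. (\<Sum>j\<le>N. G N j (real N / real (j+1)) x / p x) < U + e) at_top"
      by (rule order_tendstoD) (use \<open>e > 0\<close> in simp)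
    have "((\<lambda>x. \<Sum>j=2..N. G N j (real N / real (j-1)) x / p x) \<longlongrightarrow> L) at_top"
      unfolding L_def by (intro tendsto_sum limG) (use N in auto)
    then have 2: "eventually (\<lambda>x. (\<Sum>j=2..N. G N j (real N / real (j-1)) x / p x) > L - e) at_top"
      by (rule order_tendstoD) (use \<open>e > 0\<close> in simp)
    show ?thesis
      using 1 2 eventually_gt_at_top[of 0]
    proof eventually_elim
      case (elim x)
      then show ?case using f_le[of x] f_ge[of x] U_le L_ge by (auto simp: abs_less_iff)
    qed
  qed
  have "(f \<longlongrightarrow> C) at_top"
    unfolding tendsto_iff dist_real_def using ev[of "e / 2" for e] by auto
  then show ?thesis unfolding f_def C_def p_def .
qed

section \<open>Exceedance patterns of a stationary sequence\<close>

locale stationary_process = prob_space M for M :: "'a measure" +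
  fixes X :: "int \<Rightarrow> 'a \<Rightarrow> real"
  assumes stationary: "strictly_stationary M X"
    and nonneg: "\<And>i \<omega>. \<omega> \<in> space M \<Longrightarrow> 0 \<le> X i \<omega>"
begin

lemma measurable_X [measurable]: "X i \<in> borel_measurable M"
  using stationary by (simp add: strictly_stationary_def)

text \<open>Exceedances are prescribed at the times in \<open>I\<close> and forbidden at the times in \<open>K\<close>: this form is stable
under shifts, where stationarity acts, and under splitting at a further time.\<close>

definition pattern :: "int set \<Rightarrow> int set \<Rightarrow> real \<Rightarrow> real" where
  "pattern I K x = prob {\<omega> \<in> space M. (\<forall>i\<in>I. x < X i \<omega>) \<and> (\<forall>j\<in>K. X j \<omega> \<le> x)}"

lemma pattern_shift:
  assumes [simp]: "finite I" "finite K"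
  shows "pattern ((\<lambda>i. i + h) ` I) ((\<lambda>i. i + h) ` K) x = pattern I K x"
proof -
  define P where "P = PiM (I \<union> K) (\<lambda>_. borel :: real measure)"
  define A where "A = {f \<in> space P. (\<forall>i\<in>I. x < f i) \<and> (\<forall>j\<in>K. f j \<le> x)}"
  have comp: "(\<lambda>f. f i) \<in> borel_measurable P" if "i \<in> I \<union> K" for i
    unfolding P_def using that by simp
  have A: "A \<in> sets P"
    unfolding A_def
    by (intro sets.sets_Collect_conj sets.sets_Collect_finite_All borel_measurable_less borel_measurable_le)
       (auto intro: comp)
  have map: "(\<lambda>\<omega>. \<lambda>i\<in>I \<union> K. X (i + t) \<omega>) \<in> measurable M P" for t
    unfolding P_def by measurable
  have "pattern ((\<lambda>i. i + t) ` I) ((\<lambda>i. i + t) ` K) x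
      = measure (distr M P (\<lambda>\<omega>. \<lambda>i\<in>I \<union> K. X (i + t) \<omega>)) A" for t
    unfolding measure_distr[OF map A] unfolding pattern_def A_def
    by (rule arg_cong[where f=prob]) (auto simp: P_def space_PiM)
  from this[of h] this[of 0] show ?thesis
    using stationary unfolding strictly_stationary_def P_def by simp
qed

lemma pattern_sets [measurable]:
  assumes "finite I" "finite K"
  shows "{\<omega> \<in> space M. (\<forall>i\<in>I. x < X i \<omega>) \<and> (\<forall>j\<in>K. X j \<omega> \<le> x)} \<in> events"
  using assms by measurable

lemma pattern_antimono:
  assumes "I \<subseteq> I'" "K \<subseteq> K'" "finite I" "finite K"
  shows "pattern I' K' x \<le> pattern I K x"
  unfolding pattern_def by (rule finite_measure_mono) (use assms in auto)

lemma pattern_split: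
  assumes "finite I" "finite K"
  shows "pattern I K x = pattern (insert i I) K x + pattern I (insert i K) x"
  unfolding pattern_def
  by (subst finite_measure_Union[symmetric])
     (use assms in \<open>auto intro!: arg_cong[where f=prob] pattern_sets simp del: ball_simps\<close>)

definition tail :: "real \<Rightarrow> real" where
  "tail x = pattern {0} {} x"

text \<open>The probability that the last exceedance in \<open>{0..l}\<close> occurs at time \<open>0\<close>.\<close>

definition last_exceedance :: "nat \<Rightarrow> real \<Rightarrow> real" where
  "last_exceedance l x = pattern {0} {1..int l} x"

definition block :: "nat \<Rightarrow> real \<Rightarrow> real" where
  "block k x = prob {\<omega> \<in> space M. \<exists>i\<in>{1..int k}. x < X i \<omega>}"

text \<open>The probability of the late returns that the finite-cluster condition makes rare relative to \<open>tail x\<close>.\<close>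

definition late :: "nat \<Rightarrow> nat \<Rightarrow> real \<Rightarrow> real" where
  "late m l x = prob {\<omega> \<in> space M. x < X 0 \<omega> \<and> (\<exists>i\<in>{int m..int l}. x < X i \<omega>)}"

lemma tail_eq: "tail x = prob {\<omega> \<in> space M. x < X i \<omega>}"
  using pattern_shift[of "{0}" "{}" i x] by (simp add: tail_def pattern_def)

lemma tail_nonneg: "0 \<le> tail x"
  by (simp add: tail_def pattern_def)

lemma tail_antimono: "x \<le> y \<Longrightarrow> tail y \<le> tail x"
  unfolding tail_eq[of _ 0] by (rule finite_measure_mono) auto

lemma last_exceedance_nonneg: "0 \<le> last_exceedance l x"
  by (simp add: last_exceedance_def pattern_def)

lemma last_exceedance_antimono: "l \<le> l' \<Longrightarrow> last_exceedance l' x \<le> last_exceedance l x"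
  unfolding last_exceedance_def by (rule pattern_antimono) auto

lemma last_exceedance_le_tail: "last_exceedance l x \<le> tail x"
  unfolding last_exceedance_def tail_def by (rule pattern_antimono) auto

lemma block_sets [measurable]: "{\<omega> \<in> space M. \<exists>i\<in>{1..int k}. x < X i \<omega>} \<in> events"
  by measurable

lemma late_sets [measurable]:
  "{\<omega> \<in> space M. x < X 0 \<omega> \<and> (\<exists>i\<in>{int m..int l}. x < X i \<omega>)} \<in> events"
  by measurable

lemma block_eq_pattern: "block k x = 1 - pattern {} {1..int k} x"
proof -
  have "pattern {} {1..int k} x = prob (space M - {\<omega> \<in> space M. \<exists>i\<in>{1..int k}. x < X i \<omega>})"
    unfolding pattern_def by (rule arg_cong[where f=prob]) (auto simp: not_less)
  also have "\<dots> = 1 - block k x"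
    unfolding block_def by (rule prob_compl) (rule block_sets)
  finally show ?thesis by simp
qed

lemma shift_interval: "(\<lambda>i. i + h) ` {a..b} = {a + h..b + h :: int}"
  by (auto intro!: image_eqI[where x="_ - h"])

text \<open>By stationarity \<open>b\<^sub>k\<close> is also the probability of an exceedance in \<open>{2..k+1}\<close>. The extra event in
\<open>{1..k+1}\<close> is that time \<open>1\<close> carries the only, hence the last, exceedance.\<close>

lemma block_Suc: "block (Suc k) x = block k x + last_exceedance k x"
proof -
  have "pattern {} {1..int k} x = pattern {} {2..int k + 1} x"
    using pattern_shift[of "{}" "{1..int k}" 1 x] by (simp add: shift_interval)
  also have "\<dots> = pattern {1} {2..int k + 1} x + pattern {} (insert 1 {2..int k + 1}) x"
    by (rule pattern_split) auto
  also have "pattern {1} {2..int k + 1} x = last_exceedance k x"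
    using pattern_shift[of "{0}" "{1..int k}" 1 x] by (simp add: shift_interval last_exceedance_def)
  also have "insert 1 {2..int k + 1} = {1..int (Suc k)}" by auto
  finally show ?thesis by (simp add: block_eq_pattern)
qed

lemma block_eq_sum: "block k x = (\<Sum>l<k. last_exceedance l x)"
  by (induction k) (auto simp: block_Suc, simp add: block_def)

lemma block_le: "block k x \<le> real k * tail x"
  using sum_mono[of "{..<k}" "\<lambda>l. last_exceedance l x" "\<lambda>_. tail x"]
  by (simp add: block_eq_sum last_exceedance_le_tail)

lemma last_exceedance_0: "last_exceedance 0 x = tail x"
  by (simp add: last_exceedance_def tail_def)

lemma tail_le_block: "k \<ge> 1 \<Longrightarrow> tail x \<le> block k x"
  unfolding block_eq_sum last_exceedance_0[symmetric]
  by (rule member_le_sum) (auto simp: last_exceedance_nonneg)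

lemma block_nonneg: "0 \<le> block k x"
  by (simp add: block_def)

lemma last_exceedance_diff_le_late:
  assumes "m \<le> l"
  shows "last_exceedance m x - last_exceedance l x \<le> late m l x"
proof -
  have "last_exceedance m x \<le> prob ({\<omega> \<in> space M. (\<forall>i\<in>{0}. x < X i \<omega>) \<and> (\<forall>j\<in>{1..int l}. X j \<omega> \<le> x)}
      \<union> {\<omega> \<in> space M. x < X 0 \<omega> \<and> (\<exists>i\<in>{int m..int l}. x < X i \<omega>)})"
    unfolding last_exceedance_def pattern_def
  proof (intro finite_measure_mono subsetI)
    fix \<omega> assume "\<omega> \<in> {\<omega> \<in> space M. (\<forall>i\<in>{0}. x < X i \<omega>) \<and> (\<forall>j\<in>{1..int m}. X j \<omega> \<le> x)}"
    then show "\<omega> \<in> {\<omega> \<in> space M. (\<forall>i\<in>{0}. x < X i \<omega>) \<and> (\<forall>j\<in>{1..int l}. X j \<omega> \<le> x)}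
      \<union> {\<omega> \<in> space M. x < X 0 \<omega> \<and> (\<exists>i\<in>{int m..int l}. x < X i \<omega>)}"
      by auto (metis atLeastAtMost_iff linear not_less)
  qed (auto intro!: sets.Un late_sets pattern_sets simp del: ball_simps)
  also have "\<dots> \<le> last_exceedance l x + late m l x"
    unfolding last_exceedance_def pattern_def late_def
    by (rule measure_Un_le) (auto intro!: late_sets pattern_sets simp del: ball_simps)
  finally show ?thesis by simp
qed

lemma late_mono: "l \<le> l' \<Longrightarrow> late m l x \<le> late m l' x"
  unfolding late_def by (rule finite_measure_mono[OF _ late_sets]) auto

text \<open>The \<open>R\<close> summands \<open>q\<^sub>l\<close> of \<open>b\<^sub>R\<close> are compared with \<open>q\<^sub>m\<close>. The first \<open>m\<close> of them are off by at most
\<open>p(x)\<close>, the others by at most the probability of a late return.\<close>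

lemma block_minus_last_exceedance:
  assumes "m \<le> R"
  shows "\<bar>block R x - real R * last_exceedance m x\<bar> \<le> real m * tail x + real R * late m R x"
proof -
  have bound: "\<bar>last_exceedance l x - last_exceedance m x\<bar> \<le> (if l < m then tail x else 0) + late m R x"
    if "l < R" for l
  proof (cases "l < m")
    case True
    have "0 \<le> late m R x" by (simp add: late_def)
    moreover have "last_exceedance m x \<le> last_exceedance l x" using True by (intro last_exceedance_antimono) simp
    ultimately show ?thesis
      using last_exceedance_le_tail[of l x] last_exceedance_nonneg[of m x] True by auto
  next
    case False
    then have "last_exceedance l x \<le> last_exceedance m x" by (intro last_exceedance_antimono) simp
    moreover have "last_exceedance m x - last_exceedance l x \<le> late m R x"
      using last_exceedance_diff_le_late[of m l x] late_mono[of l R m x] False that by simp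
    ultimately show ?thesis using False by auto
  qed
  have "\<bar>block R x - real R * last_exceedance m x\<bar> = \<bar>\<Sum>l<R. last_exceedance l x - last_exceedance m x\<bar>"
    by (simp add: block_eq_sum sum_subtractf)
  also have "\<dots> \<le> (\<Sum>l<R. (if l < m then tail x else 0) + late m R x)"
    by (rule order_trans[OF sum_abs sum_mono]) (use bound in auto)
  also have "\<dots> = (\<Sum>l\<in>{..<R} \<inter> {l. l < m}. tail x) + real R * late m R x"
    by (simp add: sum.distrib sum.If_cases)
  also have "{..<R} \<inter> {l. l < m} = {..<m}" using assms by auto
  finally show ?thesis by simp
qed

text \<open>If time \<open>0\<close> is exceeded and there is no return in \<open>[m, l+m]\<close>, then the last exceedance in \<open>[0, l+m]\<close>
occurs at some \<open>j < m\<close> and is followed by at least \<open>l\<close> times without exceedance. Each of these \<open>m\<close>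
possibilities has probability at most \<open>q\<^sub>l(x)\<close>. This is what keeps the extremal index away from zero.\<close>

lemma tail_le_last_exceedance:
  "tail x - late m (l + m) x \<le> real m * last_exceedance l x"
proof -
  have int_sets: "{\<omega> \<in> space M. (\<forall>i\<in>{int j}. x < X i \<omega>) \<and> (\<forall>i\<in>{int j + 1..int (l + m)}. X i \<omega> \<le> x)} \<in> events" for j
    by (rule pattern_sets) auto
  have "tail x \<le> prob ((\<Union>j<m. {\<omega> \<in> space M. (\<forall>i\<in>{int j}. x < X i \<omega>) \<and> (\<forall>i\<in>{int j + 1..int (l + m)}. X i \<omega> \<le> x)})
      \<union> {\<omega> \<in> space M. x < X 0 \<omega> \<and> (\<exists>i\<in>{int m..int (l + m)}. x < X i \<omega>)})"
    unfolding tail_eq[of _ 0]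
  proof (intro finite_measure_mono subsetI)
    fix \<omega> assume \<omega>: "\<omega> \<in> {\<omega> \<in> space M. x < X 0 \<omega>}"
    show "\<omega> \<in> (\<Union>j<m. {\<omega> \<in> space M. (\<forall>i\<in>{int j}. x < X i \<omega>) \<and> (\<forall>i\<in>{int j + 1..int (l + m)}. X i \<omega> \<le> x)})
      \<union> {\<omega> \<in> space M. x < X 0 \<omega> \<and> (\<exists>i\<in>{int m..int (l + m)}. x < X i \<omega>)}"
    proof (cases "\<exists>i\<in>{int m..int (l + m)}. x < X i \<omega>")
      case False
      define J where "J = {j. j < m \<and> x < X (int j) \<omega>}"
      have "finite J" by (simp add: J_def)
      have "m \<noteq> 0" using False \<omega> by (intro notI) auto
      then have "0 \<in> J" using \<omega> by (simp add: J_def)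
      with \<open>finite J\<close> have Max: "Max J \<in> J" by (intro Max_in) auto
      have "X i \<omega> \<le> x" if i: "i \<in> {int (Max J) + 1..int (l + m)}" for i
      proof (rule ccontr)
        assume "\<not> X i \<omega> \<le> x"
        then have "i < int m" using False i by (metis atLeastAtMost_iff not_less)
        with i \<open>\<not> X i \<omega> \<le> x\<close> have "nat i \<in> J" by (auto simp: J_def)
        then have "nat i \<le> Max J" using \<open>finite J\<close> by simp
        with i show False by auto
      qed
      then show ?thesis using Max \<omega> by (auto simp: J_def)
    qed (use \<omega> in auto)
  qed (auto intro!: sets.Un late_sets int_sets sets.finite_UN simp del: ball_simps)
  also have "\<dots> \<le> prob (\<Union>j<m. {\<omega> \<in> space M. (\<forall>i\<in>{int j}. x < X i \<omega>) \<and> (\<forall>i\<in>{int j + 1..int (l + m)}. X i \<omega> \<le> x)})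
      + late m (l + m) x"
    unfolding late_def
    by (rule measure_Un_le) (auto intro!: sets.finite_UN late_sets int_sets simp del: ball_simps)
  also have "prob (\<Union>j<m. {\<omega> \<in> space M. (\<forall>i\<in>{int j}. x < X i \<omega>) \<and> (\<forall>i\<in>{int j + 1..int (l + m)}. X i \<omega> \<le> x)})
      \<le> (\<Sum>j<m. pattern {int j} {int j + 1..int (l + m)} x)"
    unfolding pattern_def
    by (rule finite_measure_subadditive_finite) (auto intro!: int_sets simp del: ball_simps)
  also have "\<dots> \<le> (\<Sum>j<m. last_exceedance l x)"
  proof (rule sum_mono)
    fix j assume j: "j \<in> {..<m}"
    have "pattern {int j} {int j + 1..int (l + m)} x = last_exceedance (l + m - j) x"
      using pattern_shift[of "{0}" "{1..int (l + m - j)}" "int j" x] j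
      by (simp add: shift_interval last_exceedance_def of_nat_diff add.commute)
    also have "\<dots> \<le> last_exceedance l x" by (rule last_exceedance_antimono) (use j in auto)
    finally show "pattern {int j} {int j + 1..int (l + m)} x \<le> last_exceedance l x" .
  qed
  finally show ?thesis by simp
qed

section \<open>Joint regular variation and partial maxima\<close>

lemma measurable_partial_max [measurable]: "partial_max X k \<in> borel_measurable M"
proof (cases "k = 0")
  case True
  then have "partial_max X k = (\<lambda>\<omega>. Max {})" by (simp add: partial_max_def fun_eq_iff)
  then show ?thesis by simp
next
  case False
  then show ?thesis
    unfolding partial_max_def[abs_def] by (intro borel_measurable_Max) auto
qed

lemma partial_max_gr_iff:
  assumes "k \<ge> 1"
  shows "x < partial_max X k \<omega> \<longleftrightarrow> (\<exists>i\<in>{1..int k}. x < X i \<omega>)"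
proof -
  have "{1..int k} = int ` {1..k}" by (simp add: image_int_atLeastAtMost)
  then show ?thesis
    unfolding partial_max_def using assms by (subst Max_gr_iff) auto
qed

lemma prob_partial_max_gr: "k \<ge> 1 \<Longrightarrow> prob {\<omega> \<in> space M. x < partial_max X k \<omega>} = block k x"
  unfolding block_def by (simp only: partial_max_gr_iff)

lemma prob_partial_max_le:
  assumes "k \<ge> 1"
  shows "prob {\<omega> \<in> space M. partial_max X k \<omega> \<le> x} = 1 - block k x"
proof -
  have "prob {\<omega> \<in> space M. partial_max X k \<omega> \<le> x} = prob (space M - {\<omega> \<in> space M. x < partial_max X k \<omega>})"
    by (rule arg_cong[where f=prob]) auto
  also have "\<dots> = 1 - block k x"
    by (subst prob_compl) (auto simp: prob_partial_max_gr[OF assms])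
  finally show ?thesis .
qed

lemma maxnorm_eq_partial_max:
  assumes "k \<ge> 1" "\<omega> \<in> space M"
  shows "maxnorm k (\<lambda>i\<in>{1..k}. X (int i) \<omega>) = partial_max X k \<omega>"
  unfolding maxnorm_def partial_max_def
  by (rule arg_cong[where f=Max]) (use nonneg[OF assms(2)] in \<open>auto intro!: image_cong\<close>)

lemma X_le_partial_max: "i \<in> {1..k} \<Longrightarrow> X (int i) \<omega> \<le> partial_max X k \<omega>"
  unfolding partial_max_def by (intro Max_ge) auto

lemma partial_max_nonneg:
  assumes "k \<ge> 1" "\<omega> \<in> space M"
  shows "0 \<le> partial_max X k \<omega>"
  using X_le_partial_max[of 1 k \<omega>] nonneg[OF assms(2), of 1] assms(1) by simp

lemma angle_in_sphere:
  assumes "k \<ge> 1" "\<omega> \<in> space M" "0 < partial_max X k \<omega>"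
  shows "(\<lambda>i\<in>{1..k}. X (int i) \<omega> / partial_max X k \<omega>) \<in> nonneg_sphere k"
proof -
  define R where "R = partial_max X k \<omega>"
  have "R \<in> (\<lambda>i. X (int i) \<omega>) ` {1..k}"
    unfolding R_def partial_max_def using assms(1) by (intro Max_in) auto
  then obtain i where i: "i \<in> {1..k}" "X (int i) \<omega> = R" by auto
  have "maxnorm k (\<lambda>i\<in>{1..k}. X (int i) \<omega> / R) = 1"
    unfolding maxnorm_def
  proof (rule Max_eqI)
    show "1 \<in> (\<lambda>j. \<bar>(\<lambda>i\<in>{1..k}. X (int i) \<omega> / R) j\<bar>) ` {1..k}"
      using i assms(3) by (auto simp: R_def intro!: image_eqI[of _ _ i])
    show "y \<le> 1" if "y \<in> (\<lambda>j. \<bar>(\<lambda>i\<in>{1..k}. X (int i) \<omega> / R) j\<bar>) ` {1..k}" for y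
      using that X_le_partial_max[of _ k \<omega>] nonneg[OF assms(2)] assms(3) by (auto simp: R_def)
  qed simp
  then show ?thesis
    unfolding nonneg_sphere_def R_def[symmetric]
    using nonneg[OF assms(2)] assms(3) by (auto simp: R_def intro!: divide_nonneg_pos)
qed

text \<open>This turns the weak convergence on the sphere into convergence of expectations over the original
probability space, with \<open>M\<^sub>k\<close> as radius.\<close>

lemma integral_exceedance_angle:
  fixes g :: "(nat \<Rightarrow> real) \<Rightarrow> real"
  assumes "k \<ge> 1" "0 \<le> t" "continuous_on (nonneg_sphere k) g"
  shows "(\<integral>y. g y \<partial>exceedance_angle M k (\<lambda>\<omega>. \<lambda>i\<in>{1..k}. X (int i) \<omega>) t)
      = (\<integral>\<omega>. indicator {\<omega>. partial_max X k \<omega> > t} \<omega>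
           * g (\<lambda>i\<in>{1..k}. X (int i) \<omega> / partial_max X k \<omega>) \<partial>M)"
proof -
  define A where "A = {\<omega> \<in> space M. maxnorm k (\<lambda>i\<in>{1..k}. X (int i) \<omega>) > t}"
  define T where "T \<omega> = (\<lambda>i\<in>{1..k}. X (int i) \<omega> / partial_max X k \<omega>)" for \<omega>
  have A_eq: "A = {\<omega> \<in> space M. partial_max X k \<omega> > t}"
    unfolding A_def using maxnorm_eq_partial_max[OF assms(1)] by auto
  have A: "A \<in> events" unfolding A_eq by measurable
  have T: "T \<in> measurable M borel"
    unfolding T_def[abs_def] restrict_def by (rule measurable_coordinatewise_then_product) measurable
  have T': "T \<in> measurable (restrict_space M A) (sphere_borel k)"
    unfolding sphere_borel_def
  proof (rule measurable_restrict_space2)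
    show "T \<in> space (restrict_space M A) \<rightarrow> nonneg_sphere k"
      using angle_in_sphere[OF assms(1)] assms(2) by (auto simp: space_restrict_space A_eq T_def)
    show "T \<in> borel_measurable (restrict_space M A)"
      by (rule measurable_restrict_space1[OF T])
  qed
  have g: "g \<in> borel_measurable (sphere_borel k)"
    unfolding sphere_borel_def by (rule borel_measurable_continuous_on_restrict[OF assms(3)])
  have "exceedance_angle M k (\<lambda>\<omega>. \<lambda>i\<in>{1..k}. X (int i) \<omega>) t = distr (restrict_space M A) (sphere_borel k) T"
    unfolding exceedance_angle_def A_def[symmetric]
  proof (rule distr_cong)
    fix \<omega> assume "\<omega> \<in> space (restrict_space M A)"
    then have "\<omega> \<in> space M" by (simp add: space_restrict_space)
    then show "(\<lambda>i\<in>{1..k}. (\<lambda>i\<in>{1..k}. X (int i) \<omega>) i / maxnorm k (\<lambda>i\<in>{1..k}. X (int i) \<omega>)) = T \<omega>"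
      unfolding maxnorm_eq_partial_max[OF assms(1) \<open>\<omega> \<in> space M\<close>] T_def by (intro restrict_ext) simp
  qed auto
  then have "(\<integral>y. g y \<partial>exceedance_angle M k (\<lambda>\<omega>. \<lambda>i\<in>{1..k}. X (int i) \<omega>) t)
      = (\<integral>\<omega>. g (T \<omega>) \<partial>restrict_space M A)"
    by (simp add: integral_distr[OF T' g])
  also have "\<dots> = (\<integral>\<omega>. indicator A \<omega> *\<^sub>R g (T \<omega>) \<partial>M)"
    by (rule integral_restrict_space) (use A in auto)
  also have "\<dots> = (\<integral>\<omega>. indicator {\<omega>. partial_max X k \<omega> > t} \<omega> * g (T \<omega>) \<partial>M)"
    by (rule Bochner_Integration.integral_cong) (auto simp: A_eq split: split_indicator)
  finally show ?thesis by (simp add: T_def)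
qed

text \<open>Only test functions of the first coordinate of the angle are kept: \<open>X\<^sub>1\<close> is the radius \<open>M\<^sub>k\<close> times this
coordinate.\<close>

lemma spectral_measure_limit:
  assumes "jointly_regularly_varying M X \<alpha>" "k \<ge> 1"
  obtains \<Theta> where "prob_space \<Theta>" "sets \<Theta> = sets (sphere_borel k)"
    "\<forall>u h. 0 < u \<and> continuous_on UNIV h \<and> (\<forall>t. 0 \<le> h t \<and> h t \<le> 1) \<longrightarrow>
       ((\<lambda>x. (\<integral>\<omega>. indicator {\<omega>. partial_max X k \<omega> > u * x} \<omega> * h (X 1 \<omega> / partial_max X k \<omega>) \<partial>M)
             / block k x)
          \<longlongrightarrow> u powr (-\<alpha>) * (\<integral>s. h (s 1) \<partial>\<Theta>)) at_top"
proof -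
  define \<xi> where "\<xi> = (\<lambda>\<omega>. \<lambda>i\<in>{1..k}. X (int i) \<omega>)"
  have "regularly_varying_vector M k \<xi> \<alpha>"
    using assms unfolding jointly_regularly_varying_def \<xi>_def by blast
  then obtain \<Theta> where \<Theta>: "prob_space \<Theta>" "sets \<Theta> = sets (sphere_borel k)"
    and conv: "\<And>u. u > 0 \<Longrightarrow> weakly_converges_on (nonneg_sphere k)
           (\<lambda>x. scale_measure (ennreal (1 / \<P>(\<omega> in M. maxnorm k (\<xi> \<omega>) > x)))
                  (exceedance_angle M k \<xi> (u * x)))
           (scale_measure (ennreal (u powr (- \<alpha>))) \<Theta>) at_top"
    unfolding regularly_varying_vector_def by blast
  have norm: "\<P>(\<omega> in M. maxnorm k (\<xi> \<omega>) > x) = block k x" for x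
    unfolding \<xi>_def using prob_partial_max_gr[OF assms(2), of x] maxnorm_eq_partial_max[OF assms(2)]
    by (metis (mono_tags, lifting) Collect_cong)
  show thesis
  proof (rule that[OF \<Theta>], intro allI impI, elim conjE)
    fix u :: real and h :: "real \<Rightarrow> real"
    assume u: "u > 0" and h: "continuous_on UNIV h" "\<forall>t. 0 \<le> h t \<and> h t \<le> 1"
    have cont: "continuous_on (nonneg_sphere k) (\<lambda>y. h (y 1))"
      by (rule continuous_on_compose2[OF h(1)]) (auto intro: continuous_on_product_coordinates continuous_on_subset)
    have bdd: "bounded ((\<lambda>y. h (y 1)) ` nonneg_sphere k)"
      by (rule boundedI[of _ 1]) (use h(2) in auto)
    have meas: "(\<lambda>y. h (y 1)) \<in> borel_measurable (sphere_borel k)"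
      unfolding sphere_borel_def by (rule borel_measurable_continuous_on_restrict[OF cont])
    have lhs: "(\<integral>y. h (y 1) \<partial>scale_measure (ennreal (1 / \<P>(\<omega> in M. maxnorm k (\<xi> \<omega>) > x)))
                  (exceedance_angle M k \<xi> (u * x)))
        = (\<integral>\<omega>. indicator {\<omega>. partial_max X k \<omega> > u * x} \<omega> * h (X 1 \<omega> / partial_max X k \<omega>) \<partial>M) / block k x"
      if "x > 0" for x
    proof -
      have "(\<integral>y. h (y 1) \<partial>scale_measure (ennreal (1 / \<P>(\<omega> in M. maxnorm k (\<xi> \<omega>) > x)))
                  (exceedance_angle M k \<xi> (u * x)))
          = 1 / block k x * (\<integral>y. h (y 1) \<partial>exceedance_angle M k \<xi> (u * x))"
        unfolding norm
        by (rule integral_scale_measure)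
           (use meas block_nonneg[of k x] in \<open>auto simp: exceedance_angle_def\<close>)
      also have "(\<integral>y. h (y 1) \<partial>exceedance_angle M k \<xi> (u * x))
          = (\<integral>\<omega>. indicator {\<omega>. partial_max X k \<omega> > u * x} \<omega> * h (X 1 \<omega> / partial_max X k \<omega>) \<partial>M)"
        unfolding \<xi>_def using integral_exceedance_angle[OF assms(2) _ cont, of "u * x"] u that assms(2) by simp
      finally show ?thesis by simp
    qed
    have rhs: "(\<integral>y. h (y 1) \<partial>scale_measure (ennreal (u powr (- \<alpha>))) \<Theta>) = u powr (-\<alpha>) * (\<integral>s. h (s 1) \<partial>\<Theta>)"
      using meas measurable_cong_sets[OF \<Theta>(2) refl] by (intro integral_scale_measure) auto
    have "((\<lambda>x. \<integral>y. h (y 1) \<partial>scale_measure (ennreal (1 / \<P>(\<omega> in M. maxnorm k (\<xi> \<omega>) > x)))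
                  (exceedance_angle M k \<xi> (u * x))) \<longlongrightarrow> u powr (-\<alpha>) * (\<integral>s. h (s 1) \<partial>\<Theta>)) at_top"
      unfolding rhs[symmetric]
      using conv[OF u, unfolded weakly_converges_on_def] cont bdd by blast
    then show "((\<lambda>x. (\<integral>\<omega>. indicator {\<omega>. partial_max X k \<omega> > u * x} \<omega> * h (X 1 \<omega> / partial_max X k \<omega>) \<partial>M)
             / block k x) \<longlongrightarrow> u powr (-\<alpha>) * (\<integral>s. h (s 1) \<partial>\<Theta>)) at_top"
      by (rule Lim_transform_eventually) (use lhs in \<open>auto intro: eventually_mono[OF eventually_gt_at_top[of 0]]\<close>)
  qed
qed

lemma tail_scaling:
  assumes rv: "jointly_regularly_varying M X \<alpha>" and u: "u > 0"
  shows "((\<lambda>x. tail (u * x) / tail x) \<longlongrightarrow> u powr (-\<alpha>)) at_top"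
proof -
  obtain \<Theta> where \<Theta>: "prob_space \<Theta>" and "sets \<Theta> = sets (sphere_borel 1)"
    and lim: "\<forall>u h. 0 < u \<and> continuous_on UNIV h \<and> (\<forall>t. 0 \<le> h t \<and> h t \<le> 1) \<longrightarrow>
     ((\<lambda>x. (\<integral>\<omega>. indicator {\<omega>. partial_max X 1 \<omega> > u * x} \<omega> * h (X 1 \<omega> / partial_max X 1 \<omega>) \<partial>M)
           / block 1 x)
        \<longlongrightarrow> u powr (-\<alpha>) * (\<integral>s. h (s 1) \<partial>\<Theta>)) at_top"
    by (rule spectral_measure_limit[OF rv order_refl])
  have block1: "block 1 x = tail x" for x
    by (simp add: block_eq_sum last_exceedance_0)
  have "(\<integral>\<omega>. indicator {\<omega>. partial_max X 1 \<omega> > y} \<omega> \<partial>M) = tail y" for y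
    unfolding block1[symmetric] prob_partial_max_gr[OF order_refl, symmetric]
    by (subst Bochner_Integration.integral_indicator) (auto intro!: arg_cong[where f=prob])
  then show ?thesis
    using lim[rule_format, of u "\<lambda>_. 1"] u prob_space.prob_space[OF \<Theta>]
    unfolding block1 by simp
qed

text \<open>A tail that vanishes from some point on would make the ratios in \<open>tail_scaling\<close> equal to \<open>0/0 = 0\<close>, which
does not converge to \<open>1\<close>.\<close>

lemma tail_positive:
  assumes rv: "jointly_regularly_varying M X \<alpha>"
  shows "tail x > 0"
proof -
  have "eventually (\<lambda>y. tail (1 * y) / tail y > 0) at_top"
    using tail_scaling[OF rv, of 1] by (intro order_tendstoD(1)) auto
  with eventually_ge_at_top[of x] have "eventually (\<lambda>y. tail y \<noteq> 0 \<and> y \<ge> x) at_top"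
    by eventually_elim auto
  then obtain y where "tail y \<noteq> 0" "y \<ge> x" by (auto dest: eventually_happens)
  then show ?thesis using tail_antimono[of x y] tail_nonneg[of y] by simp
qed

text \<open>The inverse ratio \<open>p(x) / b\<^sub>k(x)\<close> is the tail of the product of the radius \<open>M\<^sub>k\<close> and the angular coordinate
\<open>X\<^sub>1 / M\<^sub>k\<close>, relative to the tail of the radius. The union bound \<open>b\<^sub>k \<le> k p\<close> keeps its limit positive.\<close>

lemma block_tail_ratio_limit:
  assumes rv: "jointly_regularly_varying M X \<alpha>" and "\<alpha> > 0" and k: "k \<ge> 1"
  shows "\<exists>c. ((\<lambda>x. block k x / tail x) \<longlongrightarrow> c) at_top"
proof -
  obtain \<Theta> where \<Theta>: "prob_space \<Theta>" "sets \<Theta> = sets (sphere_borel k)"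
    and lim: "\<forall>u h. 0 < u \<and> continuous_on UNIV h \<and> (\<forall>t. 0 \<le> h t \<and> h t \<le> 1) \<longrightarrow>
       ((\<lambda>x. (\<integral>\<omega>. indicator {\<omega>. partial_max X k \<omega> > u * x} \<omega> * h (X 1 \<omega> / partial_max X k \<omega>) \<partial>M)
             / block k x)
          \<longlongrightarrow> u powr (-\<alpha>) * (\<integral>s. h (s 1) \<partial>\<Theta>)) at_top"
    by (rule spectral_measure_limit[OF rv k])
  have space: "space \<Theta> = nonneg_sphere k"
    using sets_eq_imp_space_eq[OF \<Theta>(2)] by (simp add: sphere_borel_def space_restrict_space)
  have sphere_range: "0 \<le> s 1 \<and> s 1 \<le> 1" if "s \<in> nonneg_sphere k" for s
  proof -
    have "\<bar>s 1\<bar> \<le> maxnorm k s" unfolding maxnorm_def using k by (intro Max_ge) auto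
    moreover have "0 \<le> s 1" using that k by (auto simp: nonneg_sphere_def PiE_iff)
    ultimately show ?thesis using that by (simp add: nonneg_sphere_def)
  qed
  have meas1: "(\<lambda>s. s 1) \<in> borel_measurable \<Theta>"
    unfolding measurable_cong_sets[OF \<Theta>(2) refl] sphere_borel_def
    by (intro borel_measurable_continuous_on_restrict continuous_on_subset[OF continuous_on_product_coordinates]) auto
  define c where "c = (\<integral>s. s 1 powr \<alpha> \<partial>\<Theta>)"
  \<comment> \<open>If the maximum vanishes, so does \<open>X 1\<close>, and the convention \<open>0/0 = 0\<close> keeps the identity.\<close>
  have X_eq: "partial_max X k \<omega> * (X 1 \<omega> / partial_max X k \<omega>) = X 1 \<omega>" if "\<omega> \<in> space M" for \<omega>
    using X_le_partial_max[of 1 k \<omega>] nonneg[OF that, of 1] k by (cases "partial_max X k \<omega> = 0") auto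
  have "((\<lambda>x. prob {\<omega>\<in>space M. partial_max X k \<omega> * (X 1 \<omega> / partial_max X k \<omega>) > x}
      / prob {\<omega>\<in>space M. partial_max X k \<omega> > x}) \<longlongrightarrow> (\<integral>s. s 1 powr \<alpha> \<partial>\<Theta>)) at_top"
  proof (rule product_tail_limit[OF prob_space_axioms \<Theta>(1) _ _ meas1 _ _ \<open>\<alpha> > 0\<close>])
    show "0 \<le> X 1 \<omega> / partial_max X k \<omega> \<and> X 1 \<omega> / partial_max X k \<omega> \<le> 1" if "\<omega> \<in> space M" for \<omega>
      using X_le_partial_max[of 1 k \<omega>] nonneg[OF that, of 1] partial_max_nonneg[OF k that] k
      by (auto simp: divide_le_eq)
  qed (use lim sphere_range space in \<open>auto simp: prob_partial_max_gr[OF k]\<close>)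
  also have "(\<lambda>x. prob {\<omega>\<in>space M. partial_max X k \<omega> * (X 1 \<omega> / partial_max X k \<omega>) > x}
      / prob {\<omega>\<in>space M. partial_max X k \<omega> > x}) = (\<lambda>x. tail x / block k x)"
    unfolding prob_partial_max_gr[OF k] tail_eq[of _ 1] by (simp only: X_eq cong: conj_cong)
  finally have c: "((\<lambda>x. tail x / block k x) \<longlongrightarrow> c) at_top" unfolding c_def .
  have "1 / real k \<le> tail x / block k x" for x
  proof -
    have "block k x > 0" using tail_le_block[OF k, of x] tail_positive[OF rv, of x] by linarith
    then show ?thesis using block_le[of k x] k by (simp add: field_simps)
  qed
  then have "1 / real k \<le> c"
    by (intro tendsto_lowerbound[OF c]) auto
  then have "c \<noteq> 0" using k by auto
  with c have "((\<lambda>x. inverse (tail x / block k x)) \<longlongrightarrow> inverse c) at_top"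
    by (rule tendsto_inverse)
  then show ?thesis by auto
qed

text \<open>The increments \<open>q\<^sub>l = b\<^sub>l\<^sub>+\<^sub>1 - b\<^sub>l\<close> inherit convergence from the \<open>b\<^sub>k\<close>.\<close>

lemma last_exceedance_limit:
  assumes "jointly_regularly_varying M X \<alpha>" "\<alpha> > 0"
  obtains L where "\<And>l. ((\<lambda>x. last_exceedance l x / tail x) \<longlongrightarrow> L l) at_top"
proof -
  have "\<exists>c. ((\<lambda>x. block k x / tail x) \<longlongrightarrow> c) at_top" for k
  proof (cases "k = 0")
    case True
    then show ?thesis by (auto simp: block_eq_sum)
  next
    case False
    then show ?thesis using block_tail_ratio_limit[OF assms, of k] by simp
  qed
  then obtain c where c: "\<And>k. ((\<lambda>x. block k x / tail x) \<longlongrightarrow> c k) at_top" by metis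
  have "((\<lambda>x. last_exceedance l x / tail x) \<longlongrightarrow> c (Suc l) - c l) at_top" for l
    using tendsto_diff[OF c[of "Suc l"] c[of l]] by (simp add: block_Suc diff_divide_distrib[symmetric])
  then show thesis by (rule that)
qed

lemma cond_prob_partial_max:
  assumes "l \<ge> 1"
  shows "cond_prob M (\<lambda>\<omega>. partial_max X l \<omega> \<le> x) (\<lambda>\<omega>. x < X 0 \<omega>) = last_exceedance l x / tail x"
proof -
  have "{\<omega> \<in> space M. partial_max X l \<omega> \<le> x \<and> x < X 0 \<omega>}
      = {\<omega> \<in> space M. (\<forall>i\<in>{0}. x < X i \<omega>) \<and> (\<forall>j\<in>{1..int l}. X j \<omega> \<le> x)}"
    using partial_max_gr_iff[OF assms, of x] by (auto simp: not_less[symmetric] simp del: atLeastAtMost_iff)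
  then show ?thesis unfolding cond_prob_def last_exceedance_def pattern_def tail_eq[of _ 0] by simp
qed

text \<open>The condition \<open>m \<le> R\<close> makes the index set of the maximum nonempty.\<close>

lemma late_le_cond_prob:
  assumes "m \<le> R" "tail x > 0"
  shows "late m R x \<le> cond_prob M (\<lambda>\<omega>. Max ((\<lambda>i. X i \<omega>) ` {i. int m \<le> \<bar>i\<bar> \<and> \<bar>i\<bar> \<le> int R}) > x)
      (\<lambda>\<omega>. x < X 0 \<omega>) * tail x"
proof -
  define I where "I = {i. int m \<le> \<bar>i\<bar> \<and> \<bar>i\<bar> \<le> int R}"
  have "I \<subseteq> {- int R..int R}" by (auto simp: I_def)
  then have fin: "finite I" by (rule finite_subset) simp
  have ne: "I \<noteq> {}" using assms(1) by (auto simp: I_def intro!: exI[of _ "int m"])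
  have gr: "x < Max ((\<lambda>i. X i \<omega>) ` I) \<longleftrightarrow> (\<exists>i\<in>I. x < X i \<omega>)" for \<omega>
    by (subst Max_gr_iff) (use fin ne in auto)
  have "late m R x \<le> prob {\<omega> \<in> space M. x < Max ((\<lambda>i. X i \<omega>) ` I) \<and> x < X 0 \<omega>}"
    unfolding late_def gr
  proof (rule finite_measure_mono)
    show "{\<omega> \<in> space M. x < X 0 \<omega> \<and> (\<exists>i\<in>{int m..int R}. x < X i \<omega>)}
        \<subseteq> {\<omega> \<in> space M. (\<exists>i\<in>I. x < X i \<omega>) \<and> x < X 0 \<omega>}" by (force simp: I_def)
    show "{\<omega> \<in> space M. (\<exists>i\<in>I. x < X i \<omega>) \<and> x < X 0 \<omega>} \<in> events" using fin by measurable
  qed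
  then show ?thesis
    using assms(2) unfolding cond_prob_def tail_eq[of _ 0] I_def[symmetric] by simp
qed

end

section \<open>Finite clusters and the extremal index\<close>

text \<open>The setting of the limit theorem except for the mixing condition, which enters only in the last step.
The normalisation of \<open>a\<close> is expressed through time \<open>0\<close>, as stationarity permits.\<close>

locale finite_cluster_process = stationary_process +
  fixes \<alpha> :: real and a :: "nat \<Rightarrow> real" and r :: "nat \<Rightarrow> nat"
  assumes \<alpha>_pos: "\<alpha> > 0" and rv: "jointly_regularly_varying M X \<alpha>"
    and a_pos: "\<And>n. n \<ge> 1 \<Longrightarrow> a n > 0"
    and a_quantile: "(\<lambda>n. real n * tail (a n)) \<longlonglongrightarrow> 1"
    and blocks: "block_length_sequence r"
    and cluster: "finite_cluster_condition M X a r"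
begin

lemma tail_pos: "tail x > 0"
  by (rule tail_positive[OF rv])

lemma r_at_top: "filterlim r at_top sequentially" and r_pos: "r n > 0"
  and r_small: "(\<lambda>n. real (r n) / real n) \<longlonglongrightarrow> 0"
  using blocks by (auto simp: block_length_sequence_def)

lemma a_at_top: "filterlim a at_top sequentially"
  unfolding filterlim_at_top
proof
  fix Z
  have "(\<lambda>n. real n * tail (a n) * (1 / real n)) \<longlonglongrightarrow> 1 * 0"
    by (intro tendsto_mult a_quantile lim_1_over_n)
  moreover have "eventually (\<lambda>n. real n * tail (a n) * (1 / real n) = tail (a n)) sequentially"
    using eventually_gt_at_top[of 0] by eventually_elim simp
  ultimately have "(\<lambda>n. tail (a n)) \<longlonglongrightarrow> 0"
    using Lim_transform_eventually by fastforce
  then have "eventually (\<lambda>n. tail (a n) < tail Z) sequentially"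
    by (rule order_tendstoD) (rule tail_pos)
  then show "eventually (\<lambda>n. Z \<le> a n) sequentially"
  proof eventually_elim
    case (elim n)
    then show ?case using tail_antimono[of "a n" Z] by (cases "Z \<le> a n") auto
  qed
qed

lemma ua_at_top: "u > 0 \<Longrightarrow> filterlim (\<lambda>n. u * a n) at_top sequentially"
  by (rule filterlim_tendsto_pos_mult_at_top[OF tendsto_const _ a_at_top])

lemma tail_ua: "u > 0 \<Longrightarrow> (\<lambda>n. real n * tail (u * a n)) \<longlonglongrightarrow> u powr (-\<alpha>)"
proof -
  assume u: "u > 0"
  have "(\<lambda>n. tail (u * a n) / tail (a n)) \<longlonglongrightarrow> u powr (-\<alpha>)"
    by (rule filterlim_compose[OF tail_scaling[OF rv u] a_at_top])
  then have "(\<lambda>n. real n * tail (a n) * (tail (u * a n) / tail (a n))) \<longlonglongrightarrow> 1 * u powr (-\<alpha>)"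
    by (intro tendsto_mult a_quantile)
  then show ?thesis using tail_pos by (simp add: less_imp_neq[symmetric])
qed

lemma late_eventually_small:
  assumes "u > 0" "e > 0"
  shows "eventually (\<lambda>m. eventually (\<lambda>n. late m (r n) (u * a n) \<le> e * tail (u * a n)) sequentially) sequentially"
proof -
  have "eventually (\<lambda>m. limsup (\<lambda>n. ereal
         \<P>(\<omega> in M. Max ((\<lambda>i. X i \<omega>) ` {i. int m \<le> abs i \<and> abs i \<le> int (r n)}) > u * a n
              \<bar> X 0 \<omega> > u * a n)) < ereal e) sequentially"
    using cluster assms unfolding finite_cluster_condition_def
    by (intro order_tendstoD(2)[where y=0]) auto
  then show ?thesis
  proof eventually_elim
    case (elim m)
    have "eventually (\<lambda>n. m \<le> r n) sequentially"
      using r_at_top by (simp add: filterlim_at_top)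
    with Limsup_lessD[OF elim] show ?case
    proof eventually_elim
      case (elim n)
      then show ?case
        using late_le_cond_prob[OF elim(2) tail_pos, of "u * a n"] tail_pos[of "u * a n"]
        by (auto elim!: order_trans intro!: mult_right_mono)
    qed
  qed
qed

text \<open>The sequence \<open>L\<close> is decreasing because \<open>q\<^sub>l\<close> is. For a fixed \<open>l\<close>, levels \<open>a n\<close> with \<open>r n \<ge> l + m\<close> bring the
finite-cluster condition to bear on the window \<open>[m, l+m]\<close>, and \<open>tail_le_last_exceedance\<close> gives the uniform
lower bound \<open>1/(2m)\<close>.\<close>

lemma extremal_index:
  obtains \<theta> L where "\<theta> > 0" "L \<longlonglongrightarrow> \<theta>" "\<And>l. ((\<lambda>x. last_exceedance l x / tail x) \<longlongrightarrow> L l) at_top"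
proof -
  obtain L where L: "\<And>l. ((\<lambda>x. last_exceedance l x / tail x) \<longlongrightarrow> L l) at_top"
    using last_exceedance_limit[OF rv \<alpha>_pos] by blast
  have dec: "decseq L"
  proof (rule decseq_SucI)
    fix l
    show "L (Suc l) \<le> L l"
      by (rule tendsto_le[OF _ L L])
         (auto intro!: always_eventually divide_right_mono last_exceedance_antimono tail_nonneg)
  qed
  have "eventually (\<lambda>m. eventually (\<lambda>n. late m (r n) (1 * a n) \<le> 1/2 * tail (1 * a n)) sequentially) sequentially"
    by (rule late_eventually_small) auto
  then have "eventually (\<lambda>m. m > 0 \<and> eventually (\<lambda>n. late m (r n) (a n) \<le> 1/2 * tail (a n)) sequentially) sequentially"
    using eventually_gt_at_top[of 0] by eventually_elim simp
  then obtain m where m: "m > 0" "eventually (\<lambda>n. late m (r n) (a n) \<le> 1/2 * tail (a n)) sequentially"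
    by (auto dest: eventually_happens)
  have low: "1 / (2 * real m) \<le> L l" for l
  proof -
    have "eventually (\<lambda>n. l + m \<le> r n) sequentially"
      using r_at_top by (simp add: filterlim_at_top)
    with m(2) have "eventually (\<lambda>n. 1 / (2 * real m) \<le> last_exceedance l (a n) / tail (a n)) sequentially"
    proof eventually_elim
      case (elim n)
      have "1/2 * tail (a n) \<le> real m * last_exceedance l (a n)"
        using elim(1) late_mono[OF elim(2), of m "a n"] tail_le_last_exceedance[of "a n" m l] by linarith
      then show ?case using m(1) tail_pos[of "a n"] by (simp add: field_simps)
    qed
    moreover have "(\<lambda>n. last_exceedance l (a n) / tail (a n)) \<longlonglongrightarrow> L l"
      by (rule filterlim_compose[OF L a_at_top])
    ultimately show ?thesis by (intro tendsto_lowerbound) auto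
  qed
  obtain \<theta> where \<theta>: "L \<longlonglongrightarrow> \<theta>"
    by (rule decseq_convergent[OF dec, of "1 / (2 * real m)"]) (use low in auto)
  have "1 / (2 * real m) \<le> \<theta>"
    by (rule LIMSEQ_le_const[OF \<theta>]) (use low in auto)
  then have "\<theta> > 0" using m(1) by (smt (verit) divide_pos_pos of_nat_0_less_iff)
  then show thesis using that \<theta> L by blast
qed

text \<open>Although \<open>L\<close> is obtained for windows of fixed length, its limit governs the blocks of length \<open>r n\<close>: in
\<open>block_minus_last_exceedance\<close> the fixed \<open>m\<close> costs only \<open>m / r n\<close>, and the late returns are negligible
once \<open>m\<close> is large.\<close>

lemma block_exceedance_limit:
  assumes "L \<longlonglongrightarrow> \<theta>" "\<And>l. ((\<lambda>x. last_exceedance l x / tail x) \<longlongrightarrow> L l) at_top" "u > 0"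
  shows "(\<lambda>n. block (r n) (u * a n) / (real (r n) * tail (u * a n))) \<longlonglongrightarrow> \<theta>"
proof -
  have triangle: "\<bar>b - t\<bar> < 4 * e"
    if "\<bar>b - q\<bar> \<le> d + e" "\<bar>q - l\<bar> < e" "d < e" "\<bar>l - t\<bar> < e" for b q l t d e :: real
    using that by linarith
  have main: "eventually (\<lambda>n. \<bar>block (r n) (u * a n) / (real (r n) * tail (u * a n)) - \<theta>\<bar> < 4 * e) sequentially"
    if "e > 0" for e
  proof -
    have "eventually (\<lambda>m. \<bar>L m - \<theta>\<bar> < e) sequentially"
      using tendstoD[OF assms(1) that] by (simp add: dist_real_def)
    with late_eventually_small[OF assms(3) that]
    have "eventually (\<lambda>m. \<bar>L m - \<theta>\<bar> < e \<and>
      eventually (\<lambda>n. late m (r n) (u * a n) \<le> e * tail (u * a n)) sequentially) sequentially"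
      by eventually_elim simp
    then obtain m where m: "\<bar>L m - \<theta>\<bar> < e"
      "eventually (\<lambda>n. late m (r n) (u * a n) \<le> e * tail (u * a n)) sequentially"
      by (auto dest: eventually_happens)
    have "(\<lambda>n. last_exceedance m (u * a n) / tail (u * a n)) \<longlonglongrightarrow> L m"
      by (rule filterlim_compose[OF assms(2) ua_at_top[OF assms(3)]])
    from tendstoD[OF this that]
    have 1: "eventually (\<lambda>n. \<bar>last_exceedance m (u * a n) / tail (u * a n) - L m\<bar> < e) sequentially"
      by (simp add: dist_real_def)
    have "filterlim (\<lambda>n. real (r n)) at_top sequentially"
      by (rule filterlim_compose[OF filterlim_real_sequentially r_at_top])
    then have "(\<lambda>n. real m / real (r n)) \<longlonglongrightarrow> 0"
      by (rule tendsto_divide_0[OF tendsto_const filterlim_at_top_imp_at_infinity])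
    from order_tendstoD(2)[OF this that]
    have 2: "eventually (\<lambda>n. real m / real (r n) < e) sequentially" .
    have 3: "eventually (\<lambda>n. m \<le> r n) sequentially"
      using r_at_top by (simp add: filterlim_at_top)
    show ?thesis using m(2) 1 2 3
    proof eventually_elim
      case (elim n)
      define p where "p = tail (u * a n)"
      define R where "R = real (r n)"
      have p: "p > 0" and R: "R > 0" using tail_pos r_pos by (auto simp: p_def R_def)
      have "\<bar>block (r n) (u * a n) - R * last_exceedance m (u * a n)\<bar> \<le> real m * p + R * (e * p)"
        using block_minus_last_exceedance[OF elim(4), of "u * a n"] mult_left_mono[OF elim(1), of R] R
        unfolding p_def R_def by linarith
      then have "\<bar>block (r n) (u * a n) - R * last_exceedance m (u * a n)\<bar> / (R * p)
          \<le> (real m * p + R * (e * p)) / (R * p)"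
        using p R by (intro divide_right_mono) auto
      also have "\<dots> = real m / R + e" using p R by (simp add: field_simps)
      also have "\<bar>block (r n) (u * a n) - R * last_exceedance m (u * a n)\<bar> / (R * p)
          = \<bar>block (r n) (u * a n) / (R * p) - last_exceedance m (u * a n) / p\<bar>"
      proof -
        have "block (r n) (u * a n) / (R * p) - last_exceedance m (u * a n) / p
            = (block (r n) (u * a n) - R * last_exceedance m (u * a n)) / (R * p)"
          using p R by (simp add: field_simps)
        then show ?thesis using p R by (simp add: abs_divide)
      qed
      finally show ?case
        using elim(2,3) m(1) unfolding p_def R_def by (intro triangle)
    qed
  qed
  show ?thesis
    unfolding tendsto_iff dist_real_def using main[of "e / 4" for e] by auto
qed

lemma blocks_cover: "(\<lambda>n. real (n div r n) * real (r n) / real n) \<longlonglongrightarrow> 1"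
proof (rule tendsto_sandwich)
  show "eventually (\<lambda>n. 1 - real (r n) / real n \<le> real (n div r n) * real (r n) / real n) sequentially"
    using eventually_gt_at_top[of 0]
  proof eventually_elim
    case (elim n)
    have "n = (n div r n) * r n + n mod r n" by simp
    moreover have "n mod r n \<le> r n" using r_pos[of n] by (simp add: less_imp_le)
    ultimately have "n \<le> (n div r n) * r n + r n" by linarith
    then have "real n \<le> real (n div r n) * real (r n) + real (r n)"
      by (metis of_nat_add of_nat_le_iff of_nat_mult)
    then have "real n / real n \<le> (real (n div r n) * real (r n) + real (r n)) / real n"
      by (rule divide_right_mono) simp
    then show ?case using elim by (simp add: add_divide_distrib)
  qed
  show "eventually (\<lambda>n. real (n div r n) * real (r n) / real n \<le> 1) sequentially"
    using eventually_gt_at_top[of 0]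
  proof eventually_elim
    case (elim n)
    have "(n div r n) * r n \<le> n" by simp
    then have "real (n div r n) * real (r n) \<le> real n" by (metis of_nat_le_iff of_nat_mult)
    then show ?case using elim by simp
  qed
  show "(\<lambda>n. 1 - real (r n) / real n) \<longlonglongrightarrow> 1"
    using tendsto_diff[OF tendsto_const r_small, of 1] by simp
qed simp

text \<open>There are about \<open>n / r n\<close> blocks, each exceeds \<open>u a n\<close> with probability about \<open>\<theta> r n p(u a n)\<close>, and
\<open>n p(u a n)\<close> tends to \<open>u\<^sup>-\<^sup>\<alpha>\<close>.\<close>

lemma block_intensity:
  assumes "L \<longlonglongrightarrow> \<theta>" "\<And>l. ((\<lambda>x. last_exceedance l x / tail x) \<longlongrightarrow> L l) at_top" "u > 0"
  shows "(\<lambda>n. real (n div r n) * block (r n) (u * a n)) \<longlonglongrightarrow> \<theta> * u powr (-\<alpha>)"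
    and "(\<lambda>n. block (r n) (u * a n)) \<longlonglongrightarrow> 0"
proof -
  note lims = blocks_cover block_exceedance_limit[OF assms] tail_ua[OF assms(3)]
  have "(\<lambda>n. (real (n div r n) * real (r n) / real n) * (block (r n) (u * a n) / (real (r n) * tail (u * a n)))
      * (real n * tail (u * a n))) \<longlonglongrightarrow> 1 * \<theta> * u powr (-\<alpha>)"
    by (intro tendsto_mult lims)
  moreover have "eventually (\<lambda>n. (real (n div r n) * real (r n) / real n) * (block (r n) (u * a n) / (real (r n) * tail (u * a n)))
      * (real n * tail (u * a n)) = real (n div r n) * block (r n) (u * a n)) sequentially"
    using eventually_gt_at_top[of 0]
    by eventually_elim (use tail_pos r_pos in \<open>simp add: less_imp_neq[symmetric]\<close>)
  ultimately show "(\<lambda>n. real (n div r n) * block (r n) (u * a n)) \<longlonglongrightarrow> \<theta> * u powr (-\<alpha>)"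
    by (auto elim: Lim_transform_eventually)
  have "(\<lambda>n. (real (r n) / real n) * (block (r n) (u * a n) / (real (r n) * tail (u * a n)))
      * (real n * tail (u * a n))) \<longlonglongrightarrow> 0 * \<theta> * u powr (-\<alpha>)"
    by (intro tendsto_mult lims r_small)
  moreover have "eventually (\<lambda>n. (real (r n) / real n) * (block (r n) (u * a n) / (real (r n) * tail (u * a n)))
      * (real n * tail (u * a n)) = block (r n) (u * a n)) sequentially"
    using eventually_gt_at_top[of 0]
    by eventually_elim (use tail_pos r_pos in \<open>simp add: less_imp_neq[symmetric]\<close>)
  ultimately show "(\<lambda>n. block (r n) (u * a n)) \<longlonglongrightarrow> 0"
    by (auto elim: Lim_transform_eventually)
qed

end

section \<open>Laplace functionals of ramp functions\<close>

text \<open>A test function constant in time, rising linearly from \<open>0\<close> to \<open>s\<close> between the levels \<open>x\<close> and \<open>x'\<close>. Truncation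
at \<open>x'\<close> comes before the conversion to a real number, as the latter would send \<open>\<infinity>\<close> to \<open>0\<close>.\<close>

definition ramp :: "real \<Rightarrow> real \<Rightarrow> real \<Rightarrow> real \<times> ereal \<Rightarrow> real" where
  "ramp s x x' p = (if fst p \<in> {0..1}
     then s * clamp01 ((real_of_ereal (min (snd p) (ereal x')) - x) / (x' - x)) else 0)"

lemma ramp_eq_0:
  assumes "0 < x" "x < x'" "y \<le> ereal x"
  shows "ramp s x x' (t, y) = 0"
  using assms by (cases y) (auto simp: ramp_def clamp01_def min_def divide_le_0_iff)

lemma ramp_real:
  assumes "x < x'"
  shows "y \<ge> x' \<Longrightarrow> t \<in> {0..1} \<Longrightarrow> ramp s x x' (t, ereal y) = s"
    and "0 \<le> s \<Longrightarrow> 0 \<le> ramp s x x' p"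
    and "t \<in> {0..1} \<Longrightarrow> t' \<in> {0..1} \<Longrightarrow> ramp s x x' (t, z) = ramp s x x' (t', z)"
  using assms by (auto simp: ramp_def clamp01_def min_def)

lemma test_function_ramp:
  assumes "0 \<le> s" "0 < x" "x < x'"
  shows "test_function (ramp s x x')"
  unfolding test_function_def
proof (intro conjI allI impI)
  show "0 \<le> ramp s x x' p" for p by (rule ramp_real(2)) (use assms in auto)
  show "ramp s x x' p = 0" if "p \<notin> time_state_space" for p
  proof (cases "fst p \<in> {0..1}")
    case True
    then have "snd p \<le> 0" using that by (cases p) (auto simp: time_state_space_def)
    then have "snd p \<le> ereal x" using assms(2) by (meson ereal_less(2) less_imp_le order_trans)
    then show ?thesis using ramp_eq_0[OF assms(2,3), of "snd p" s "fst p"] by simp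
  qed (auto simp: ramp_def)
  have fin: "min (snd p) (ereal x') \<in> UNIV - {\<infinity>, -\<infinity>}" if "p \<in> time_state_space" for p
    using that assms by (cases "snd p") (auto simp: time_state_space_def min_def)
  have "continuous_on time_state_space
     (\<lambda>p. s * clamp01 ((real_of_ereal (min (snd p) (ereal x')) - x) / (x' - x)))"
    by (intro continuous_intros continuous_on_compose2[OF continuous_on_real]) (use fin assms in auto)
  then show "continuous_on time_state_space (ramp s x x')"
    by (rule continuous_on_eq) (auto simp: ramp_def time_state_space_def)
  define K where "K = {0..1::real} \<times> {ereal x..}"
  have "compact {ereal x..}"
    using closed_Int_compact[OF _ compact_UNIV, of "{ereal x..}"] by simp
  then have K: "compact K" unfolding K_def by (intro compact_Times) auto
  have KE: "K \<subseteq> time_state_space"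
    unfolding K_def time_state_space_def using assms(2) by (auto intro: less_le_trans[of 0 "ereal x"])
  have sub: "{p \<in> time_state_space. ramp s x x' p \<noteq> 0} \<subseteq> K"
  proof
    fix p assume p: "p \<in> {p \<in> time_state_space. ramp s x x' p \<noteq> 0}"
    then have "\<not> snd p \<le> ereal x" using ramp_eq_0[OF assms(2,3), of "snd p" s "fst p"] by auto
    then show "p \<in> K" using p by (cases p) (auto simp: K_def time_state_space_def)
  qed
  have "closed K" using K by (rule compact_imp_closed)
  then have cl: "closure {p \<in> time_state_space. ramp s x x' p \<noteq> 0} \<subseteq> K"
    using sub by (intro closure_minimal)
  have "time_state_space \<inter> closure {p \<in> time_state_space. ramp s x x' p \<noteq> 0}
      = closure {p \<in> time_state_space. ramp s x x' p \<noteq> 0} \<inter> K"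
    using cl KE by auto
  then show "compact (time_state_space \<inter> closure {p \<in> time_state_space. ramp s x x' p \<noteq> 0})"
    using closed_Int_compact[OF _ K] by simp
qed

context stationary_process
begin

text \<open>The exponential inside the expectation equals one when no observation exceeds the lower level, and it is
at most \<open>exp (- s)\<close> as soon as one observation exceeds the upper level.\<close>

lemma laplace_bounds:
  fixes g :: "real \<Rightarrow> real"
  assumes [measurable]: "g \<in> borel_measurable borel" and g: "\<And>y. 0 \<le> g y" "\<And>y. y \<le> x \<Longrightarrow> g y = 0"
    "\<And>y. y > x' \<Longrightarrow> s \<le> g y" and s: "0 \<le> s" and c: "c > 0"
  shows "1 - block k (x * c) \<le> (\<integral>\<omega>. exp (- (\<Sum>i=1..k. g (X (int i) \<omega> / c))) \<partial>M)"
    and "(\<integral>\<omega>. exp (- (\<Sum>i=1..k. g (X (int i) \<omega> / c))) \<partial>M) \<le> 1 - (1 - exp (- s)) * block k (x' * c)"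
proof -
  define B where "B y = {\<omega> \<in> space M. \<exists>i\<in>{1..int k}. y * c < X i \<omega>}" for y
  define S where "S \<omega> = (\<Sum>i=1..k. g (X (int i) \<omega> / c))" for \<omega>
  have [measurable]: "B y \<in> events" for y unfolding B_def by (rule block_sets)
  have [measurable]: "S \<in> borel_measurable M" unfolding S_def by measurable
  have S0: "0 \<le> S \<omega>" for \<omega> unfolding S_def using g(1) by (intro sum_nonneg) auto
  have int_exp: "integrable M (\<lambda>\<omega>. exp (- S \<omega>))"
    by (rule integrable_const_bound[of _ 1]) (use S0 in auto)
  have int_B: "integrable M (\<lambda>\<omega>. 1 - d * indicator (B y) \<omega>)" for d y :: real
    by (intro Bochner_Integration.integrable_diff integrable_mult_right integrable_real_indicator)
       (auto simp: emeasure_eq_measure)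
  have exp_B: "(\<integral>\<omega>. 1 - d * indicator (B y) \<omega> \<partial>M) = 1 - d * block k (y * c)" for d y
  proof -
    have "(\<integral>\<omega>. 1 - d * indicator (B y) \<omega> \<partial>M) = (\<integral>\<omega>. 1 \<partial>M) - (\<integral>\<omega>. d * indicator (B y) \<omega> \<partial>M)"
      by (intro Bochner_Integration.integral_diff integrable_mult_right integrable_real_indicator)
         (auto simp: emeasure_eq_measure)
    also have "\<dots> = 1 - d * prob (B y)" by (simp add: prob_space)
    finally show ?thesis by (simp add: block_def B_def)
  qed
  have "1 - 1 * block k (x * c) \<le> (\<integral>\<omega>. exp (- S \<omega>) \<partial>M)"
    unfolding exp_B[symmetric]
  proof (rule integral_mono[OF int_B int_exp])
    fix \<omega> assume \<omega>: "\<omega> \<in> space M"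
    show "1 - 1 * indicator (B x) \<omega> \<le> exp (- S \<omega>)"
    proof (cases "\<omega> \<in> B x")
      case False
      have "g (X (int i) \<omega> / c) = 0" if "i \<in> {1..k}" for i
        using False \<omega> that c by (intro g(2)) (auto simp: B_def not_less divide_le_eq)
      then show ?thesis using False by (simp add: S_def)
    qed simp
  qed
  then show "1 - block k (x * c) \<le> (\<integral>\<omega>. exp (- (\<Sum>i=1..k. g (X (int i) \<omega> / c))) \<partial>M)"
    by (simp add: S_def)
  have "(\<integral>\<omega>. exp (- S \<omega>) \<partial>M) \<le> 1 - (1 - exp (- s)) * block k (x' * c)"
    unfolding exp_B[symmetric]
  proof (rule integral_mono[OF int_exp int_B])
    fix \<omega> assume \<omega>: "\<omega> \<in> space M"
    show "exp (- S \<omega>) \<le> 1 - (1 - exp (- s)) * indicator (B x') \<omega>"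
    proof (cases "\<omega> \<in> B x'")
      case True
      then obtain i where i: "i \<in> {1..int k}" "x' * c < X i \<omega>" by (auto simp: B_def)
      then have "s \<le> g (X (int (nat i)) \<omega> / c)"
        using c by (intro g(3)) (auto simp: less_divide_eq)
      also have "\<dots> \<le> S \<omega>"
        unfolding S_def by (rule member_le_sum) (use i g(1) in auto)
      finally show ?thesis using True by simp
    qed (use S0 in simp)
  qed
  then show "(\<integral>\<omega>. exp (- (\<Sum>i=1..k. g (X (int i) \<omega> / c))) \<partial>M) \<le> 1 - (1 - exp (- s)) * block k (x' * c)"
    by (simp add: S_def)
qed

end

section \<open>From independent blocks to the Frechet limit\<close>

context finite_cluster_process
begin

text \<open>The two Laplace functionals in the mixing condition, for the whole sample and for one block, are both
squeezed by \<open>laplace_bounds\<close>. Here \<open>N\<close> is the functional of the whole sample, and \<open>V\<close> and \<open>U\<close> are powers of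
the block bounds, corrected by the mixing error. Since the ramp is constant in time, the product
over the blocks is a power.\<close>

lemma block_laplace_power_bounds:
  assumes "mixing_condition M X a r"
    and "L \<longlonglongrightarrow> \<theta>" "\<And>l. ((\<lambda>x. last_exceedance l x / tail x) \<longlongrightarrow> L l) at_top"
    and x: "0 < x" "x < x'" and s: "0 \<le> s"
  obtains N U V where
    "eventually (\<lambda>n. 1 - block n (x * a n) \<le> N n \<and> N n \<le> 1 - (1 - exp (- s)) * block n (x' * a n)) sequentially"
    "eventually (\<lambda>n. V n \<le> N n \<and> N n \<le> U n) sequentially"
    "V \<longlonglongrightarrow> exp (- (\<theta> * x powr (-\<alpha>)))"
    "U \<longlonglongrightarrow> exp (- ((1 - exp (- s)) * (\<theta> * x' powr (-\<alpha>))))"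
proof -
  define f where "f = ramp s x x'"
  define g where "g y = f (0, ereal y)" for y
  have f_eq: "f (t, ereal y) = g y" if "t \<in> {0..1}" for t y
    unfolding f_def g_def by (rule ramp_real(3)) (use x that in auto)
  have meas: "g \<in> borel_measurable borel"
  proof -
    have "g = (\<lambda>y. s * min 1 (max 0 ((min y x' - x) / (x' - x))))"
      by (rule ext) (simp add: g_def f_def ramp_def clamp01_def flip: ereal_min)
    then show ?thesis by simp
  qed
  have g: "0 \<le> g y" "y \<le> x \<Longrightarrow> g y = 0" "y > x' \<Longrightarrow> s \<le> g y" for y
    using ramp_real(2)[OF x(2) s] ramp_eq_0[OF x, of "ereal y" s 0] ramp_real(1)[OF x(2), of y 0 s]
    by (auto simp: g_def f_def)
  define \<Psi> where "\<Psi> k n = (\<integral>\<omega>. exp (- (\<Sum>i=1..k. g (X (int i) \<omega> / a n))) \<partial>M)" for k n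
  define d where "d n = \<Psi> n n - \<Psi> (r n) n ^ (n div r n)" for n
  have "d \<longlonglongrightarrow> 0"
  proof -
    have "(\<lambda>n. (\<integral>\<omega>. exp (- (\<Sum>i=1..n. f (real i / real n, ereal (X (int i) \<omega> / a n)))) \<partial>M)
          - (\<Prod>k=1..n div r n.
              \<integral>\<omega>. exp (- (\<Sum>i=1..r n. f (real (k * r n) / real n, ereal (X (int i) \<omega> / a n)))) \<partial>M))
       \<longlonglongrightarrow> 0"
      using assms(1) test_function_ramp[OF s x] unfolding mixing_condition_def f_def by blast
    also have "(\<lambda>n. (\<integral>\<omega>. exp (- (\<Sum>i=1..n. f (real i / real n, ereal (X (int i) \<omega> / a n)))) \<partial>M)
          - (\<Prod>k=1..n div r n.
              \<integral>\<omega>. exp (- (\<Sum>i=1..r n. f (real (k * r n) / real n, ereal (X (int i) \<omega> / a n)))) \<partial>M)) = d"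
    proof
      fix n
      have 1: "(\<Sum>i=1..n. f (real i / real n, ereal (X (int i) \<omega> / a n))) = (\<Sum>i=1..n. g (X (int i) \<omega> / a n))" for \<omega>
        by (rule sum.cong) (auto intro!: f_eq simp: divide_le_eq)
      have 2: "f (real (k * r n) / real n, ereal y) = g y" if "k \<in> {1..n div r n}" for k y
      proof (rule f_eq)
        have "k * r n \<le> (n div r n) * r n" using that by (intro mult_le_mono1) auto
        also have "\<dots> \<le> n" by simp
        finally have "real (k * r n) \<le> real n" by (rule of_nat_mono)
        then show "real (k * r n) / real n \<in> {0..1}" by (auto simp: divide_le_eq)
      qed
      have "(\<Prod>k=1..n div r n.
              \<integral>\<omega>. exp (- (\<Sum>i=1..r n. f (real (k * r n) / real n, ereal (X (int i) \<omega> / a n)))) \<partial>M)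
          = (\<Prod>k=1..n div r n. \<Psi> (r n) n)"
        by (rule prod.cong) (simp_all only: 2 \<Psi>_def)
      then show "(\<integral>\<omega>. exp (- (\<Sum>i=1..n. f (real i / real n, ereal (X (int i) \<omega> / a n)))) \<partial>M)
          - (\<Prod>k=1..n div r n.
              \<integral>\<omega>. exp (- (\<Sum>i=1..r n. f (real (k * r n) / real n, ereal (X (int i) \<omega> / a n)))) \<partial>M) = d n"
        unfolding 1 by (simp add: d_def \<Psi>_def)
    qed
    finally show ?thesis .
  qed
  have bounds: "1 - block k (x * a n) \<le> \<Psi> k n" "\<Psi> k n \<le> 1 - (1 - exp (- s)) * block k (x' * a n)"
    if "n \<ge> 1" for k n
    unfolding \<Psi>_def
    by (rule laplace_bounds[OF meas g s a_pos[OF that]]; assumption)+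
  define V where "V n = (1 - block (r n) (x * a n)) ^ (n div r n) + d n" for n
  define U where "U n = (1 - (1 - exp (- s)) * block (r n) (x' * a n)) ^ (n div r n) + d n" for n
  have "0 < x'" using x by simp
  note I = block_intensity[OF assms(2,3) x(1)] and I' = block_intensity[OF assms(2,3) \<open>0 < x'\<close>]
  show thesis
  proof (rule that)
    show "eventually (\<lambda>n. 1 - block n (x * a n) \<le> \<Psi> n n \<and> \<Psi> n n \<le> 1 - (1 - exp (- s)) * block n (x' * a n)) sequentially"
      using eventually_ge_at_top[of 1] by eventually_elim (use bounds in auto)
    show "eventually (\<lambda>n. V n \<le> \<Psi> n n \<and> \<Psi> n n \<le> U n) sequentially"
      using eventually_ge_at_top[of 1]
    proof eventually_elim
      case (elim n)
      have le1: "block (r n) (x * a n) \<le> 1" by (simp add: block_def)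
      have "(1 - block (r n) (x * a n)) ^ (n div r n) \<le> \<Psi> (r n) n ^ (n div r n)"
        using bounds(1)[OF elim, of "r n"] le1 by (intro power_mono) auto
      moreover have "\<Psi> (r n) n ^ (n div r n) \<le> (1 - (1 - exp (- s)) * block (r n) (x' * a n)) ^ (n div r n)"
        using bounds[OF elim, of "r n"] le1 by (intro power_mono) auto
      ultimately show ?case by (simp add: U_def V_def d_def)
    qed
    have "V \<longlonglongrightarrow> exp (- (\<theta> * x powr (-\<alpha>))) + 0"
      unfolding V_def
      by (intro tendsto_add tendsto_one_minus_power_exp I \<open>d \<longlonglongrightarrow> 0\<close>) (rule block_nonneg)
    then show "V \<longlonglongrightarrow> exp (- (\<theta> * x powr (-\<alpha>)))" by simp
    have "(\<lambda>n. (1 - exp (- s)) * block (r n) (x' * a n)) \<longlonglongrightarrow> (1 - exp (- s)) * 0"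
      by (intro tendsto_mult tendsto_const I')
    moreover have "(\<lambda>n. (1 - exp (- s)) * (real (n div r n) * block (r n) (x' * a n)))
        \<longlonglongrightarrow> (1 - exp (- s)) * (\<theta> * x' powr (-\<alpha>))"
      by (intro tendsto_mult tendsto_const I')
    ultimately have "U \<longlonglongrightarrow> exp (- ((1 - exp (- s)) * (\<theta> * x' powr (-\<alpha>)))) + 0"
      unfolding U_def
      by (intro tendsto_add tendsto_one_minus_power_exp \<open>d \<longlonglongrightarrow> 0\<close>)
         (use s in \<open>auto simp: block_nonneg mult_ac\<close>)
    then show "U \<longlonglongrightarrow> exp (- ((1 - exp (- s)) * (\<theta> * x' powr (-\<alpha>))))" by simp
  qed
qed

text \<open>The upper bound for the probability of no exceedance uses the ramp on \<open>[y, y + y/j]\<close> and the lower bound the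
ramp on \<open>[y - y/j, y]\<close>, both of height \<open>j\<close>. As \<open>j\<close> grows both bounds tend to the Frechet value.\<close>

lemma block_limit:
  assumes mix: "mixing_condition M X a r"
    and L: "L \<longlonglongrightarrow> \<theta>" "\<And>l. ((\<lambda>x. last_exceedance l x / tail x) \<longlongrightarrow> L l) at_top"
    and y: "0 < y"
  shows "(\<lambda>n. 1 - block n (y * a n)) \<longlonglongrightarrow> exp (- (\<theta> * y powr (-\<alpha>)))"
proof (rule order_tendstoI)
  have s_lim: "(\<lambda>j. 1 - exp (- real j)) \<longlonglongrightarrow> 1 - 0"
    by (intro tendsto_diff tendsto_const filterlim_compose[OF exp_at_bot]
        filterlim_compose[OF filterlim_uminus_at_bot_at_top] filterlim_real_sequentially)
  have inv_lim: "(\<lambda>j. y / real j) \<longlonglongrightarrow> 0" by (rule lim_const_over_n)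
  fix c assume c: "c > exp (- (\<theta> * y powr (-\<alpha>)))"
  have "(\<lambda>j. exp (- ((1 - exp (- real j)) * (\<theta> * (y + y / real j) powr (-\<alpha>)))))
      \<longlonglongrightarrow> exp (- ((1 - 0) * (\<theta> * (y + 0) powr (-\<alpha>))))"
    by (intro tendsto_intros s_lim inv_lim) (use y in auto)
  then have "eventually (\<lambda>j. exp (- ((1 - exp (- real j)) * (\<theta> * (y + y / real j) powr (-\<alpha>)))) < c) sequentially"
    by (rule order_tendstoD) (use c in simp)
  then have "eventually (\<lambda>j. j \<ge> 1 \<and> exp (- ((1 - exp (- real j)) * (\<theta> * (y + y / real j) powr (-\<alpha>)))) < c) sequentially"
    using eventually_ge_at_top[of 1] by eventually_elim simp
  then obtain j :: nat where j: "j \<ge> 1" "exp (- ((1 - exp (- real j)) * (\<theta> * (y + y / real j) powr (-\<alpha>)))) < c"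
    by (auto dest: eventually_happens)
  have y': "y < y + y / real j" using y j by simp
  obtain N U V where 1: "eventually (\<lambda>n. 1 - block n (y * a n) \<le> N n \<and> N n \<le> 1 - (1 - exp (- real j)) * block n ((y + y / real j) * a n)) sequentially"
    and 2: "eventually (\<lambda>n. V n \<le> N n \<and> N n \<le> U n) sequentially"
    and "V \<longlonglongrightarrow> exp (- (\<theta> * y powr (-\<alpha>)))"
    and U: "U \<longlonglongrightarrow> exp (- ((1 - exp (- real j)) * (\<theta> * (y + y / real j) powr (-\<alpha>))))"
    by (rule block_laplace_power_bounds[OF mix L y y', of "real j"]) auto
  from order_tendstoD(2)[OF U j(2)] 1 2
  show "eventually (\<lambda>n. 1 - block n (y * a n) < c) sequentially"
    by eventually_elim linarith
next
  have s_lim: "(\<lambda>j. 1 - exp (- real j)) \<longlonglongrightarrow> 1 - 0"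
    by (intro tendsto_diff tendsto_const filterlim_compose[OF exp_at_bot]
        filterlim_compose[OF filterlim_uminus_at_bot_at_top] filterlim_real_sequentially)
  have inv_lim: "(\<lambda>j. y / real j) \<longlonglongrightarrow> 0" by (rule lim_const_over_n)
  fix c assume c: "c < exp (- (\<theta> * y powr (-\<alpha>)))"
  have "(\<lambda>j. 1 - (1 - exp (- (\<theta> * (y - y / real j) powr (-\<alpha>)))) / (1 - exp (- real j)))
      \<longlonglongrightarrow> 1 - (1 - exp (- (\<theta> * (y - 0) powr (-\<alpha>)))) / (1 - 0)"
    by (intro tendsto_intros s_lim inv_lim) (use y in auto)
  then have "eventually (\<lambda>j. c < 1 - (1 - exp (- (\<theta> * (y - y / real j) powr (-\<alpha>)))) / (1 - exp (- real j))) sequentially"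
    by (rule order_tendstoD) (use c in simp)
  then have "eventually (\<lambda>j. j \<ge> 2 \<and> c < 1 - (1 - exp (- (\<theta> * (y - y / real j) powr (-\<alpha>)))) / (1 - exp (- real j))) sequentially"
    using eventually_ge_at_top[of 2] by eventually_elim simp
  then obtain j :: nat where j: "j \<ge> 2" "c < 1 - (1 - exp (- (\<theta> * (y - y / real j) powr (-\<alpha>)))) / (1 - exp (- real j))"
    by (auto dest: eventually_happens)
  \<comment> \<open>The choice \<open>j \<ge> 2\<close> keeps the lower level of the ramp positive.\<close>
  have y': "0 < y - y / real j" "y - y / real j < y" using y j by (auto simp: field_simps)
  have q: "1 - exp (- real j) > 0" using j by simp
  obtain N U V where 1: "eventually (\<lambda>n. 1 - block n ((y - y / real j) * a n) \<le> N n \<and> N n \<le> 1 - (1 - exp (- real j)) * block n (y * a n)) sequentially"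
    and 2: "eventually (\<lambda>n. V n \<le> N n \<and> N n \<le> U n) sequentially"
    and V: "V \<longlonglongrightarrow> exp (- (\<theta> * (y - y / real j) powr (-\<alpha>)))"
    and "U \<longlonglongrightarrow> exp (- ((1 - exp (- real j)) * (\<theta> * y powr (-\<alpha>))))"
    by (rule block_laplace_power_bounds[OF mix L y', of "real j"]) auto
  have "(\<lambda>n. 1 - (1 - V n) / (1 - exp (- real j)))
      \<longlonglongrightarrow> 1 - (1 - exp (- (\<theta> * (y - y / real j) powr (-\<alpha>)))) / (1 - exp (- real j))"
    by (intro tendsto_intros V) (use q in auto)
  from order_tendstoD(1)[OF this j(2)] 1 2
  show "eventually (\<lambda>n. c < 1 - block n (y * a n)) sequentially"
  proof eventually_elim
    case (elim n)
    have "(1 - exp (- real j)) * block n (y * a n) \<le> 1 - V n" using elim by linarith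
    then have "block n (y * a n) \<le> (1 - V n) / (1 - exp (- real j))" using q by (simp add: field_simps)
    then show ?case using elim by linarith
  qed
qed

text \<open>At positive points this is \<open>block_limit\<close>. At a point \<open>x \<le> 0\<close> the distribution functions are dominated by
their values at small positive points, where the Frechet distribution function is arbitrarily small.\<close>

lemma weak_conv_frechet:
  assumes mix: "mixing_condition M X a r"
    and L: "L \<longlonglongrightarrow> \<theta>" "\<And>l. ((\<lambda>x. last_exceedance l x / tail x) \<longlongrightarrow> L l) at_top"
    and \<mu>: "frechet_law \<theta> \<alpha> \<mu>"
  shows "weak_conv_m (\<lambda>n. distr M borel (\<lambda>\<omega>. partial_max X n \<omega> / a n)) \<mu>"
proof -
  interpret \<mu>: real_distribution \<mu> using \<mu> by (simp add: frechet_law_def)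
  define G where "G n = cdf (distr M borel (\<lambda>\<omega>. partial_max X n \<omega> / a n))" for n
  have G: "G n x = 1 - block n (x * a n)" if "n \<ge> 1" for n x
  proof -
    have "G n x = prob {\<omega> \<in> space M. partial_max X n \<omega> \<le> x * a n}"
      unfolding G_def cdf_def
      by (subst measure_distr) (use a_pos[OF that] in \<open>auto intro!: arg_cong[where f=prob] simp: divide_le_eq\<close>)
    then show ?thesis by (simp add: prob_partial_max_le[OF that])
  qed
  have pos: "(\<lambda>n. G n x) \<longlonglongrightarrow> cdf \<mu> x" if "x > 0" for x
  proof -
    have "cdf \<mu> x = exp (- (\<theta> * x powr (-\<alpha>)))"
      using \<mu> that by (simp add: frechet_law_def cdf_def)
    with block_limit[OF mix L that] have "(\<lambda>n. 1 - block n (x * a n)) \<longlonglongrightarrow> cdf \<mu> x" by simp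
    then show ?thesis
      by (rule Lim_transform_eventually) (use G in \<open>auto intro: eventually_mono[OF eventually_ge_at_top[of 1]]\<close>)
  qed
  have small: "\<exists>\<epsilon>>0. cdf \<mu> \<epsilon> < e" if "e > 0" for e
  proof -
    have \<theta>: "\<theta> > 0" using \<mu> by (simp add: frechet_law_def)
    have "((\<lambda>x. exp (- \<theta> * x powr (- \<alpha>))) \<longlongrightarrow> 0) (at_right 0)"
      using \<theta> \<alpha>_pos by real_asymp
    then have "eventually (\<lambda>x. exp (- \<theta> * x powr (- \<alpha>)) < e) (at_right 0)"
      by (rule order_tendstoD) (rule that)
    then have "eventually (\<lambda>x. x > 0 \<and> cdf \<mu> x < e) (at_right 0)"
      using eventually_at_right_less[of 0]
      by eventually_elim (use \<mu> in \<open>auto simp: frechet_law_def cdf_def\<close>)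
    then show ?thesis by (auto dest!: eventually_happens)
  qed
  have nonpos: "(\<lambda>n. G n x) \<longlonglongrightarrow> cdf \<mu> x" if "x \<le> 0" for x
  proof -
    have "cdf \<mu> x \<le> cdf \<mu> \<epsilon>" if "\<epsilon> > 0" for \<epsilon>
      using \<mu>.cdf_nondecreasing[of x \<epsilon>] that \<open>x \<le> 0\<close> by simp
    then have "\<not> cdf \<mu> x > 0" using small[of "cdf \<mu> x"] by (meson not_le)
    then have zero: "cdf \<mu> x = 0" using \<mu>.cdf_nonneg[of x] by simp
    have "(\<lambda>n. G n x) \<longlonglongrightarrow> 0"
    proof (rule order_tendstoI)
      fix e :: real assume "e < 0"
      have "e < G n x" for n
        by (rule less_le_trans[OF \<open>e < 0\<close>]) (simp add: G_def cdf_def)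
      then show "eventually (\<lambda>n. e < G n x) sequentially" by simp
    next
      fix e :: real assume "e > 0"
      then obtain \<epsilon> where \<epsilon>: "\<epsilon> > 0" "cdf \<mu> \<epsilon> < e" using small by blast
      have "G n x \<le> G n \<epsilon>" for n
      proof -
        interpret D: prob_space "distr M borel (\<lambda>\<omega>. partial_max X n \<omega> / a n)"
          by (rule prob_space_distr) measurable
        show ?thesis unfolding G_def cdf_def by (rule D.finite_measure_mono) (use that \<epsilon> in auto)
      qed
      then show "eventually (\<lambda>n. G n x < e) sequentially"
        using order_tendstoD(2)[OF pos[OF \<epsilon>(1)] \<epsilon>(2)] by (auto elim!: eventually_mono intro: le_less_trans)
    qed
    then show ?thesis by (simp add: zero)
  qed
  show ?thesis
    unfolding weak_conv_m_def weak_conv_def G_def[symmetric] using pos nonpos by (meson not_le)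
qed

end

theorem theorem3p1:
  fixes M :: "'a measure" and X :: "int \<Rightarrow> 'a \<Rightarrow> real" and \<alpha> :: real
    and a :: "nat \<Rightarrow> real"
  assumes "prob_space M"
    and "strictly_stationary M X"
    and "\<And>i \<omega>. \<omega> \<in> space M \<Longrightarrow> 0 \<le> X i \<omega>"
    and "\<alpha> > 0"
    and "jointly_regularly_varying M X \<alpha>"
    and "\<And>n. n \<ge> 1 \<Longrightarrow> a n > 0"
    and "(\<lambda>n. real n * \<P>(\<omega> in M. X 1 \<omega> > a n)) \<longlonglongrightarrow> 1"
    and "\<exists>r. block_length_sequence r \<and> finite_cluster_condition M X a r \<and> mixing_condition M X a r"
  shows "\<exists>\<theta> \<mu>. iterated_limit_theta M X \<theta> \<and> frechet_law \<theta> \<alpha> \<mu> \<and>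
           weak_conv_m (\<lambda>n. distr M borel (\<lambda>\<omega>. partial_max X n \<omega> / a n)) \<mu>"
proof -
  from assms(8) obtain r where r: "block_length_sequence r" "finite_cluster_condition M X a r"
    and mix: "mixing_condition M X a r" by blast
  interpret stationary_process M X
    using assms(1-3) by (simp add: stationary_process_def stationary_process_axioms_def)
  interpret finite_cluster_process M X \<alpha> a r
    using assms(4-7) r by unfold_locales (auto simp: tail_eq[of _ 1])
  obtain \<theta> L where \<theta>: "\<theta> > 0" and L: "L \<longlonglongrightarrow> \<theta>" "\<And>l. ((\<lambda>x. last_exceedance l x / tail x) \<longlongrightarrow> L l) at_top"
    using extremal_index by blast
  have "iterated_limit_theta M X \<theta>"
    unfolding iterated_limit_theta_def
    by (intro exI[of _ L] conjI allI impI) (use L in \<open>simp_all only: cond_prob_partial_max\<close>)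
  moreover obtain \<mu> where \<mu>: "frechet_law \<theta> \<alpha> \<mu>"
    using frechet_law_exists[OF \<theta> \<alpha>_pos] by blast
  moreover have "weak_conv_m (\<lambda>n. distr M borel (\<lambda>\<omega>. partial_max X n \<omega> / a n)) \<mu>"
    by (rule weak_conv_frechet[OF mix L \<mu>])
  ultimately show ?thesis by blast
qed

end
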